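(* Let $(G,\tau)$ be a reflexive abelian topological group of finite exponent. Then $(G,\tau)$ is a Mackey group.
   Context: Let $\mathbb{S}$ be the unit circle group and $\mathbb{S}_+=\{z\in\mathbb{S}:\ \mathrm{Re}(z)\ge 0\}$. For an abelian topological group $G$, $\widehat{G}$ is the group of all continuous characters, i.e. continuous homomorphisms $G\to\mathbb{S}$, and $G^\wedge$ is $\widehat{G}$ endowed with the compact-open topology; $G^{\wedge\wedge}=(G^\wedge)^\wedge$. The group $G$ is reflexive if the canonical homomorphism $\alpha_G:G\to G^{\wedge\wedge}$, $g\mapsto(\chi\mapsto\chi(g))$, is a topological isomorphism. $G$ has finite exponent if there is a positive integer $n$ with $ng=0$ for all $g\in G$. $G$ is maximally almost periodic (MAP) if $\widehat{G}$ separates the points of $G$. A subset $A\subseteq G$ is quasi-convex if for every $g\in G\setminus A$ there is $\chi\in\widehat{G}$ with $\chi(g)\notin\mathbb{S}_+$ and $\chi(A)\subseteq\mathbb{S}_+$. $G$ is locally quasi-convex if it has a neighborhood base at $0$ consisting of quasi-convex sets; locally quasi-convex groups are understood to be MAP. Two group topologies $\tau,\nu$ on an abelian group $G$ are compatible if $\widehat{(G,\tau)}=\widehat{(G,\nu)}$. A locally quasi-convex abelian group $(G,\tau)$ is a Mackey group if every locally quasi-convex group topology $\nu$ on $G$ compatible with $\tau$ satisfies $\nu\le\tau$. *)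

theory Defs
  imports "HOL-Analysis.Analysis" "HOL-Algebra.Group"
begin

text \<open>
  Groups are written multiplicatively, as in \<open>HOL-Algebra\<close>. A topological group is a pair of a
  group \<open>G\<close> and a topology \<open>T\<close> with \<open>topspace T = carrier G\<close>, so that several topologies can be
  put on the same group. No separation axiom is assumed.
\<close>

definition topological_group :: "('a, 'm) monoid_scheme \<Rightarrow> 'a topology \<Rightarrow> bool" where
  "topological_group G T \<longleftrightarrow>
     group G \<and> topspace T = carrier G \<and>
     continuous_map (prod_topology T T) T (\<lambda>(x, y). x \<otimes>\<^bsub>G\<^esub> y) \<and>
     continuous_map T T (\<lambda>x. inv\<^bsub>G\<^esub> x)"

definition abelian_topological_group :: "('a, 'm) monoid_scheme \<Rightarrow> 'a topology \<Rightarrow> bool" where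
  "abelian_topological_group G T \<longleftrightarrow> comm_group G \<and> topological_group G T"

definition circle_group :: "complex monoid" where
  "circle_group = \<lparr>carrier = sphere 0 1, mult = (*), one = 1\<rparr>"

abbreviation circle_topology :: "complex topology" where
  "circle_topology \<equiv> top_of_set (sphere 0 1)"

definition circle_plus :: "complex set" where
  "circle_plus = {z \<in> sphere 0 1. 0 \<le> Re z}"

text \<open>
  Maps out of \<open>G\<close> are represented by functions that are \<open>undefined\<close> outside \<open>carrier G\<close>, so that
  equality of characters as HOL functions is equality of maps on \<open>carrier G\<close>.
\<close>

definition characters :: "('a, 'm) monoid_scheme \<Rightarrow> 'a topology \<Rightarrow> ('a \<Rightarrow> complex) set" where
  "characters G T =
     {\<phi> \<in> extensional (carrier G). \<phi> \<in> hom G circle_group \<and> continuous_map T circle_topology \<phi>}"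

definition dual_group :: "('a, 'm) monoid_scheme \<Rightarrow> 'a topology \<Rightarrow> ('a \<Rightarrow> complex) monoid" where
  "dual_group G T =
     \<lparr>carrier = characters G T,
      mult = (\<lambda>\<phi> \<psi>. \<lambda>x\<in>carrier G. \<phi> x * \<psi> x),
      one = (\<lambda>x\<in>carrier G. 1)\<rparr>"

definition compact_open_topology :: "'a topology \<Rightarrow> 'b topology \<Rightarrow> ('a \<Rightarrow> 'b) topology" where
  "compact_open_topology X Y =
     topology_generated_by
       {{f \<in> extensional (topspace X). continuous_map X Y f \<and> f ` K \<subseteq> U} | K U.
          compactin X K \<and> openin Y U}"

definition dual_topology :: "('a, 'm) monoid_scheme \<Rightarrow> 'a topology \<Rightarrow> ('a \<Rightarrow> complex) topology" where
  "dual_topology G T = subtopology (compact_open_topology T circle_topology) (characters G T)"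

definition bidual_group ::
    "('a, 'm) monoid_scheme \<Rightarrow> 'a topology \<Rightarrow> (('a \<Rightarrow> complex) \<Rightarrow> complex) monoid" where
  "bidual_group G T = dual_group (dual_group G T) (dual_topology G T)"

definition bidual_topology ::
    "('a, 'm) monoid_scheme \<Rightarrow> 'a topology \<Rightarrow> (('a \<Rightarrow> complex) \<Rightarrow> complex) topology" where
  "bidual_topology G T = dual_topology (dual_group G T) (dual_topology G T)"

definition canonical_hom ::
    "('a, 'm) monoid_scheme \<Rightarrow> 'a topology \<Rightarrow> 'a \<Rightarrow> ('a \<Rightarrow> complex) \<Rightarrow> complex" where
  "canonical_hom G T g = (\<lambda>\<phi>\<in>characters G T. \<phi> g)"

definition reflexive_group :: "('a, 'm) monoid_scheme \<Rightarrow> 'a topology \<Rightarrow> bool" where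
  "reflexive_group G T \<longleftrightarrow>
     canonical_hom G T \<in> iso G (bidual_group G T) \<and>
     homeomorphic_map T (bidual_topology G T) (canonical_hom G T)"

definition finite_exponent :: "('a, 'm) monoid_scheme \<Rightarrow> bool" where
  "finite_exponent G \<longleftrightarrow> (\<exists>n::nat. 0 < n \<and> (\<forall>g\<in>carrier G. g [^]\<^bsub>G\<^esub> n = \<one>\<^bsub>G\<^esub>))"

definition maximally_almost_periodic :: "('a, 'm) monoid_scheme \<Rightarrow> 'a topology \<Rightarrow> bool" where
  "maximally_almost_periodic G T \<longleftrightarrow>
     (\<forall>g\<in>carrier G. \<forall>h\<in>carrier G. g \<noteq> h \<longrightarrow> (\<exists>\<phi>\<in>characters G T. \<phi> g \<noteq> \<phi> h))"

definition quasi_convex :: "('a, 'm) monoid_scheme \<Rightarrow> 'a topology \<Rightarrow> 'a set \<Rightarrow> bool" where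
  "quasi_convex G T A \<longleftrightarrow>
     A \<subseteq> carrier G \<and>
     (\<forall>g\<in>carrier G - A. \<exists>\<phi>\<in>characters G T. \<phi> g \<notin> circle_plus \<and> \<phi> ` A \<subseteq> circle_plus)"

text \<open>
  By convention, local quasi-convexity here includes being maximally almost periodic, which does
  not follow from the neighbourhood base condition alone.
\<close>

definition locally_quasi_convex :: "('a, 'm) monoid_scheme \<Rightarrow> 'a topology \<Rightarrow> bool" where
  "locally_quasi_convex G T \<longleftrightarrow>
     maximally_almost_periodic G T \<and> neighbourhood_base_at \<one>\<^bsub>G\<^esub> (quasi_convex G T) T"

definition compatible_topologies ::
    "('a, 'm) monoid_scheme \<Rightarrow> 'a topology \<Rightarrow> 'a topology \<Rightarrow> bool" where
  "compatible_topologies G T N \<longleftrightarrow> characters G T = characters G N"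

definition mackey_group :: "('a, 'm) monoid_scheme \<Rightarrow> 'a topology \<Rightarrow> bool" where
  "mackey_group G T \<longleftrightarrow>
     abelian_topological_group G T \<and> locally_quasi_convex G T \<and>
     (\<forall>N. abelian_topological_group G N \<and> locally_quasi_convex G N \<and> compatible_topologies G T N
        \<longrightarrow> (\<forall>U. openin N U \<longrightarrow> openin T U))"

lemma comm_group_circle_group: "comm_group circle_group"
proof (rule comm_groupI)
  fix x assume "x \<in> carrier circle_group"
  then have "norm x = 1"
    by (simp add: circle_group_def)
  then have "norm (inverse x) = 1" "x \<noteq> 0"
    by (auto simp: norm_inverse)
  then show "\<exists>y\<in>carrier circle_group. y \<otimes>\<^bsub>circle_group\<^esub> x = \<one>\<^bsub>circle_group\<^esub>"
    by (intro bexI[of _ "inverse x"]) (auto simp: circle_group_def)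
qed (auto simp: circle_group_def norm_mult)

lemma topspace_compact_open_topology:
  "topspace (compact_open_topology X Y) = {f \<in> extensional (topspace X). continuous_map X Y f}"
  (is "?L = ?R")
proof
  show "?L \<subseteq> ?R"
    by (auto simp: compact_open_topology_def topology_generated_by_topspace)
  have "?R \<in> {{f \<in> extensional (topspace X). continuous_map X Y f \<and> f ` K \<subseteq> U} | K U.
                compactin X K \<and> openin Y U}"
    by (intro CollectI exI[of _ "{}"]) auto
  then show "?R \<subseteq> ?L"
    unfolding compact_open_topology_def topology_generated_by_topspace by (rule Union_upper)
qed

lemma topspace_dual_topology:
  assumes "topspace T = carrier G"
  shows "topspace (dual_topology G T) = carrier (dual_group G T)"
  using assms
  by (auto simp: dual_topology_def dual_group_def topspace_compact_open_topology characters_def)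

end

theory Submission imports Defs begin

text \<open>
  Let \<open>n\<close> be an exponent of \<open>G\<close> and \<open>X\<close> its character group. All characters take values
  in the \<open>n\<close>-th roots of unity, a finite set, so neighbourhoods given by inequalities on the circle
  can be replaced by exact equations, and the relevant topologies turn out to be linear. In a locally quasi-convex group of
  exponent \<open>n\<close> those annihilators of sets of characters that are open form a neighbourhood base at the identity
  (\<open>locally_quasi_convex_imp_linear\<close>), and in the compact-open topology a character has the base
  of neighbourhoods consisting of the characters that agree with it on a compact set
  (\<open>openin_dual_topology_agree\<close>, \<open>dual_topology_nhd\<close>). Reading the latter in the bidual, reflexivity
  says that the topology of \<open>G\<close> is that of the annihilators of compact subsets of \<open>X\<close>.

  Now let \<open>N\<close> be a compatible locally quasi-convex topology and \<open>H\<close> an \<open>N\<close>-open subgroup that is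
  the annihilator of a set of characters. Let \<open>K\<close> be the group of characters trivial on \<open>H\<close>, so
  that \<open>H\<close> is the annihilator of \<open>K\<close>. Every homomorphism to the circle that is trivial on \<open>H\<close> is
  \<open>N\<close>-continuous, hence \<open>K\<close> is pointwise compact by Tychonoff's theorem. If \<open>K\<close> is also compact in
  the compact-open topology of the original \<open>T\<close>, then \<open>H\<close> is \<open>T\<close>-open by reflexivity, and we are done.

  So the point is that the pointwise and the compact-open topology coincide on \<open>K\<close>, i.e. that the
  elements of \<open>K\<close> have only finitely many restrictions to a given \<open>T\<close>-compact set \<open>C\<close>
  (\<open>finite_restrictions_of_pointwise_compact\<close>). Suppose there are infinitely many,
  realised by a sequence \<open>k i\<close> in \<open>K\<close>, and let \<open>D\<close> be the group of
  all characters that agree on \<open>C\<close> with a product of the \<open>k i\<close>. As \<open>D\<close> is open in the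
  compact-open topology, homomorphisms on \<open>X\<close> that are trivial on \<open>D\<close> are continuous, hence evaluations at
  points of \<open>G\<close> by reflexivity; since bounded abelian groups have enough homomorphisms to the circle
  (\<open>character_separating_submonoid\<close>), \<open>D\<close> is pointwise closed. Therefore \<open>K \<inter> D\<close> is a compact
  Hausdorff group that is covered by countably many pointwise closed cosets of the subgroup of
  characters trivial on \<open>C\<close>. By Baire's theorem one of them has interior points; translates of its interior
  cover \<open>K \<inter> D\<close>, so by compactness there are only finitely many of them, although the \<open>k i\<close> lie in distinct ones.
\<close>

section \<open>Roots of unity on the circle\<close>

text \<open>
  If \<open>z\<close> is not \<open>1\<close>, its first \<open>n\<close> powers sum to \<open>0\<close>; since the zeroth power contributes \<open>1\<close>, another one must
  have negative real part. This turns membership in the right half circle into triviality.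
\<close>
lemma root_of_unity_eq_1:
  fixes z :: complex
  assumes "z ^ n = 1" "0 < n" "\<And>m. m < n \<Longrightarrow> 0 \<le> Re (z ^ m)"
  shows "z = 1"
proof (rule ccontr)
  assume "z \<noteq> 1"
  then have "(\<Sum>m<n. z ^ m) = 0"
    using assms(1) by (simp add: geometric_sum)
  then have "(\<Sum>m<n. Re (z ^ m)) = 0"
    by (metis Re_sum zero_complex.sel(1))
  moreover have "Re (z ^ 0) \<le> (\<Sum>m<n. Re (z ^ m))"
    using assms by (intro member_le_sum) auto
  ultimately show False
    by simp
qed

lemma circle_nth_root:
  fixes w :: complex
  assumes "norm w = 1" "0 < m"
  obtains z where "norm z = 1" "z ^ m = w"
proof
  show "norm (cis (Arg w / m)) = 1" by simp
  show "cis (Arg w / m) ^ m = w"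
  proof -
    have "w \<noteq> 0" using assms by auto
    then have "cis (Arg w) = w" using assms by (simp add: cis_Arg sgn_div_norm)
    moreover have "real m * (Arg w / real m) = Arg w" using assms by simp
    ultimately show ?thesis by (subst Complex.DeMoivre) simp
  qed
qed

lemma nontrivial_root_of_unity:
  assumes "2 \<le> (m::nat)"
  obtains z :: complex where "norm z = 1" "z ^ m = 1" "z \<noteq> 1"
proof -
  have "card {z::complex. z ^ m = 1} = m"
    using assms by (intro card_roots_unity_eq) auto
  moreover have "card {z::complex. z ^ m = 1} \<le> 1" if "{z::complex. z ^ m = 1} \<subseteq> {1}"
    using card_mono[OF _ that] by simp
  ultimately obtain z :: complex where "z ^ m = 1" "z \<noteq> 1"
    using assms by fastforce
  moreover from this have "norm z = 1"
    using assms power_eq_imp_eq_base[of "norm z" m 1] by (simp flip: norm_power)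
  ultimately show ?thesis using that by blast
qed

section \<open>Separating submonoids by characters of a bounded group\<close>

text \<open>
  The graph of a homomorphism from a submonoid to the circle. In a group of finite exponent inverses
  are powers, so closure under multiplication suffices, and a trivial fibre over the identity is what
  makes the relation single-valued. Working with graphs makes the union of a chain immediate.
\<close>
definition partial_character_graph :: "('a, 'm) monoid_scheme \<Rightarrow> ('a \<times> complex) set \<Rightarrow> bool" where
  "partial_character_graph X R \<longleftrightarrow>
     R \<subseteq> carrier X \<times> sphere 0 1 \<and> (\<one>\<^bsub>X\<^esub>, 1) \<in> R \<and>
     (\<forall>a u b v. (a, u) \<in> R \<longrightarrow> (b, v) \<in> R \<longrightarrow> (a \<otimes>\<^bsub>X\<^esub> b, u * v) \<in> R) \<and>
     (\<forall>u. (\<one>\<^bsub>X\<^esub>, u) \<in> R \<longrightarrow> u = 1)"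

lemma partial_character_graph_pow:
  assumes "group X" "partial_character_graph X R" "(a, u) \<in> R"
  shows "(a [^]\<^bsub>X\<^esub> (k::nat), u ^ k) \<in> R"
proof -
  interpret group X by fact
  show ?thesis
  proof (induction k)
    case 0
    then show ?case using assms by (simp add: partial_character_graph_def)
  next
    case (Suc k)
    then have "(a [^]\<^bsub>X\<^esub> k \<otimes>\<^bsub>X\<^esub> a, u ^ k * u) \<in> R"
      using assms unfolding partial_character_graph_def by blast
    then show ?case by (simp add: mult.commute)
  qed
qed

lemma partial_character_graph_unique:
  assumes "group X" "partial_character_graph X R" "0 < n"
    and exponent: "\<And>x. x \<in> carrier X \<Longrightarrow> x [^]\<^bsub>X\<^esub> (n::nat) = \<one>\<^bsub>X\<^esub>"
    and "(a, u) \<in> R" "(a, v) \<in> R"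
  shows "u = v"
proof -
  interpret group X by fact
  have a: "a \<in> carrier X" using assms by (auto simp: partial_character_graph_def)
  obtain k where n: "n = Suc k" using \<open>0 < n\<close> by (cases n) auto
  have pow: "(a [^]\<^bsub>X\<^esub> k, v ^ k) \<in> R"
    by (rule partial_character_graph_pow) fact+
  have *: "w * v ^ k = 1" if "(a, w) \<in> R" for w
  proof -
    have "(a [^]\<^bsub>X\<^esub> k \<otimes>\<^bsub>X\<^esub> a, v ^ k * w) \<in> R"
      using assms pow that unfolding partial_character_graph_def by blast
    moreover have "a [^]\<^bsub>X\<^esub> k \<otimes>\<^bsub>X\<^esub> a = \<one>\<^bsub>X\<^esub>"
      using exponent[OF a] n by simp
    ultimately show ?thesis using assms unfolding partial_character_graph_def by (metis mult.commute)
  qed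
  have "u * v ^ k = v * v ^ k" "v ^ k \<noteq> 0" using *[OF \<open>(a,u)\<in>R\<close>] *[OF \<open>(a,v)\<in>R\<close>] by auto
  then show ?thesis using mult_right_cancel by blast
qed

text \<open>
  Adjoining a new element \<open>y\<close>: its value \<open>z\<close> is only constrained by the least positive power of \<open>y\<close>
  that already lies in the domain. The trivial fibre is preserved because every power of \<open>y\<close> in the
  domain is a power of that least one.
\<close>
lemma partial_character_graph_extend:
  assumes "comm_group X" and R: "partial_character_graph X R" and "0 < n"
    and exponent: "\<And>x. x \<in> carrier X \<Longrightarrow> x [^]\<^bsub>X\<^esub> (n::nat) = \<one>\<^bsub>X\<^esub>"
    and y: "y \<in> carrier X" and "0 < m" and ym: "(y [^]\<^bsub>X\<^esub> m, z ^ m) \<in> R"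
    and least: "\<And>r. 0 < r \<Longrightarrow> r < m \<Longrightarrow> y [^]\<^bsub>X\<^esub> r \<notin> Domain R"
    and z: "norm z = 1"
  shows "partial_character_graph X {(a \<otimes>\<^bsub>X\<^esub> y [^]\<^bsub>X\<^esub> (k::nat), u * z ^ k) | a u k. (a, u) \<in> R}"
    (is "partial_character_graph X ?R'")
proof -
  interpret comm_group X by fact
  have carr: "a \<in> carrier X" "norm u = 1" if "(a, u) \<in> R" for a u
    using R that by (auto simp: partial_character_graph_def)
  have mult: "(a \<otimes>\<^bsub>X\<^esub> b, u * v) \<in> R" if "(a, u) \<in> R" "(b, v) \<in> R" for a b u v
    using R that by (auto simp: partial_character_graph_def)
  note pow = partial_character_graph_pow[OF group_axioms R]
  have "?R' \<subseteq> carrier X \<times> sphere 0 1"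
    using y z by (auto simp: norm_mult norm_power carr)
  moreover have "(\<one>\<^bsub>X\<^esub>, 1) \<in> ?R'"
  proof -
    have "(\<one>\<^bsub>X\<^esub>, 1) \<in> R" using R by (auto simp: partial_character_graph_def)
    then show ?thesis
      by (intro CollectI exI[of _ "\<one>\<^bsub>X\<^esub>"] exI[of _ "1::complex"] exI[of _ "0::nat"]) auto
  qed
  moreover have "(a \<otimes>\<^bsub>X\<^esub> b, u * v) \<in> ?R'" if "(a, u) \<in> ?R'" "(b, v) \<in> ?R'" for a b u v
  proof -
    from that obtain a' u' k b' v' l where *: "a = a' \<otimes>\<^bsub>X\<^esub> y [^]\<^bsub>X\<^esub> (k::nat)" "u = u' * z ^ k" "(a', u') \<in> R"
      "b = b' \<otimes>\<^bsub>X\<^esub> y [^]\<^bsub>X\<^esub> (l::nat)" "v = v' * z ^ l" "(b', v') \<in> R" by blast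
    have "a \<otimes>\<^bsub>X\<^esub> b = (a' \<otimes>\<^bsub>X\<^esub> b') \<otimes>\<^bsub>X\<^esub> y [^]\<^bsub>X\<^esub> (k + l)"
      using * y carr by (simp add: m_ac flip: nat_pow_mult)
    moreover have "u * v = (u' * v') * z ^ (k + l)"
      using * by (simp add: power_add)
    ultimately show ?thesis using mult * by blast
  qed
  moreover have "u * z ^ k = 1" if au: "(a, u) \<in> R" and eq: "a \<otimes>\<^bsub>X\<^esub> y [^]\<^bsub>X\<^esub> (k::nat) = \<one>\<^bsub>X\<^esub>" for a u k
  proof -
    obtain n' where n: "n = Suc n'" using \<open>0 < n\<close> by (cases n) auto
    define q where "q = k div m"
    define r where "r = k mod m"
    have k: "k = m * q + r" by (simp add: q_def r_def)
    have a: "a \<in> carrier X" using carr au by blast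
    have yq: "(y [^]\<^bsub>X\<^esub> (m * q), z ^ (m * q)) \<in> R"
      using pow[OF ym, of q] y by (simp add: nat_pow_pow power_mult)
    have "a \<otimes>\<^bsub>X\<^esub> y [^]\<^bsub>X\<^esub> (m * q) \<otimes>\<^bsub>X\<^esub> y [^]\<^bsub>X\<^esub> r = \<one>\<^bsub>X\<^esub>"
      using eq y a by (simp add: k m_assoc flip: nat_pow_mult)
    moreover define b where "b = a \<otimes>\<^bsub>X\<^esub> y [^]\<^bsub>X\<^esub> (m * q)"
    ultimately have b: "b \<otimes>\<^bsub>X\<^esub> y [^]\<^bsub>X\<^esub> r = \<one>\<^bsub>X\<^esub>" by simp
    have bR: "(b, u * z ^ (m * q)) \<in> R" unfolding b_def by (rule mult[OF au yq])
    have "b [^]\<^bsub>X\<^esub> n' \<otimes>\<^bsub>X\<^esub> b = \<one>\<^bsub>X\<^esub>"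
      using exponent[of b] n carr[OF bR] by simp
    then have "y [^]\<^bsub>X\<^esub> r = b [^]\<^bsub>X\<^esub> n'"
      using b y carr[OF bR] by (metis inv_equality m_comm nat_pow_closed)
    then have "y [^]\<^bsub>X\<^esub> r \<in> Domain R" using pow[OF bR, of n'] by auto
    moreover have "r < m" using \<open>0 < m\<close> by (simp add: r_def)
    ultimately have "r = 0" using least[of r] by (cases "r = 0") auto
    with b carr[OF bR] have "b = \<one>\<^bsub>X\<^esub>" by simp
    with bR R have "u * z ^ (m * q) = 1" by (auto simp: partial_character_graph_def)
    then show ?thesis using k \<open>r = 0\<close> by simp
  qed
  then have "\<forall>u. (\<one>\<^bsub>X\<^esub>, u) \<in> ?R' \<longrightarrow> u = 1" by force
  ultimately show ?thesis
    unfolding partial_character_graph_def by (intro conjI allI impI; (assumption | blast))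
qed

lemma partial_character_graph_least_power:
  assumes "group X" "partial_character_graph X R" "0 < (n::nat)" "y [^]\<^bsub>X\<^esub> n = \<one>\<^bsub>X\<^esub>"
  obtains m where "0 < m" "y [^]\<^bsub>X\<^esub> m \<in> Domain R" "\<And>r::nat. 0 < r \<Longrightarrow> r < m \<Longrightarrow> y [^]\<^bsub>X\<^esub> r \<notin> Domain R"
proof -
  let ?P = "\<lambda>m::nat. 0 < m \<and> y [^]\<^bsub>X\<^esub> m \<in> Domain R"
  have "(\<one>\<^bsub>X\<^esub>, 1) \<in> R" using assms by (simp add: partial_character_graph_def)
  then have "?P n" using assms by auto
  then have "?P (LEAST m. ?P m)" by (rule LeastI)
  then show ?thesis using that[of "LEAST m. ?P m"] not_less_Least[of _ ?P] by blast
qed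

text \<open>
  Starting from the trivial homomorphism on \<open>B\<close>, the element \<open>x\<close> can be given a nontrivial value: the
  least power of \<open>x\<close> in \<open>B\<close> has exponent at least \<open>2\<close>, so a nontrivial root of unity of
  that order is admissible. A maximal extension is defined everywhere because the circle is divisible.
\<close>
lemma character_separating_submonoid:
  assumes "comm_group X" and "0 < n"
    and exponent: "\<And>x. x \<in> carrier X \<Longrightarrow> x [^]\<^bsub>X\<^esub> (n::nat) = \<one>\<^bsub>X\<^esub>"
    and B: "B \<subseteq> carrier X" "\<one>\<^bsub>X\<^esub> \<in> B" "\<And>a b. a \<in> B \<Longrightarrow> b \<in> B \<Longrightarrow> a \<otimes>\<^bsub>X\<^esub> b \<in> B"
    and x: "x \<in> carrier X" "x \<notin> B"
  obtains \<phi> where "\<phi> \<in> hom X circle_group" "\<phi> \<in> extensional (carrier X)"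
    "\<And>b. b \<in> B \<Longrightarrow> \<phi> b = 1" "\<phi> x \<noteq> 1"
proof -
  interpret comm_group X by fact
  have B1: "partial_character_graph X (B \<times> {1})"
    using B by (auto simp: partial_character_graph_def)
  obtain m where m: "0 < m" "x [^]\<^bsub>X\<^esub> m \<in> Domain (B \<times> {1::complex})"
    "\<And>r::nat. 0 < r \<Longrightarrow> r < m \<Longrightarrow> x [^]\<^bsub>X\<^esub> r \<notin> Domain (B \<times> {1::complex})"
    using partial_character_graph_least_power[OF group_axioms B1 \<open>0 < n\<close> exponent[OF x(1)]] by blast
  have "m \<noteq> 1" using m x by auto
  then obtain z :: complex where z: "norm z = 1" "z ^ m = 1" "z \<noteq> 1"
    using m(1) nontrivial_root_of_unity[of m] by auto
  define R0 where "R0 = {(a \<otimes>\<^bsub>X\<^esub> x [^]\<^bsub>X\<^esub> (k::nat), u * z ^ k) | a u k. (a, u) \<in> B \<times> {1::complex}}"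
  \<comment> \<open>the trivial homomorphism on \<open>B\<close>, extended by \<open>x \<mapsto> z\<close>\<close>
  have R0: "partial_character_graph X R0"
    unfolding R0_def
    by (rule partial_character_graph_extend[where n = n and m = m])
      (use B1 m z x assms in auto)
  have BR0: "(b, 1) \<in> R0" if "b \<in> B" for b
    unfolding R0_def using that B
    by (intro CollectI exI[of _ b] exI[of _ "1::complex"] exI[of _ "0::nat"]) auto
  have xR0: "(x, z) \<in> R0"
    unfolding R0_def using B x
    by (intro CollectI exI[of _ "\<one>\<^bsub>X\<^esub>"] exI[of _ "1::complex"] exI[of _ "1::nat"]) auto
  let ?A = "{R. partial_character_graph X R \<and> R0 \<subseteq> R}"
  have "\<exists>M\<in>?A. \<forall>R\<in>?A. M \<subseteq> R \<longrightarrow> R = M"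
  proof (rule subset_Zorn_nonempty)
    show "?A \<noteq> {}" using R0 by blast
  next
    fix C assume ne: "C \<noteq> {}" and ch: "subset.chain ?A C"
    then have CA: "C \<subseteq> ?A" by (simp add: subset_chain_def)
    have "(a \<otimes>\<^bsub>X\<^esub> b, u * v) \<in> \<Union>C" if "(a, u) \<in> \<Union>C" "(b, v) \<in> \<Union>C" for a b u v
    proof -
      from that ch have "\<exists>R\<in>C. (a, u) \<in> R \<and> (b, v) \<in> R"
        unfolding subset_chain_def by blast
      then show ?thesis using CA unfolding partial_character_graph_def by blast
    qed
    moreover have "\<Union>C \<subseteq> carrier X \<times> sphere 0 1" "(\<one>\<^bsub>X\<^esub>, 1) \<in> \<Union>C"
      "\<forall>u. (\<one>\<^bsub>X\<^esub>, u) \<in> \<Union>C \<longrightarrow> u = 1"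
      using CA ne unfolding partial_character_graph_def by blast+
    ultimately have "partial_character_graph X (\<Union>C)"
      unfolding partial_character_graph_def by blast
    then show "\<Union>C \<in> ?A" using CA ne by blast
  qed
  then obtain M where M: "partial_character_graph X M" "R0 \<subseteq> M"
    and maxM: "\<And>R. partial_character_graph X R \<Longrightarrow> M \<subseteq> R \<Longrightarrow> R = M"
    by (smt (verit, best) mem_Collect_eq subset_trans)
  have total: "\<exists>u. (y, u) \<in> M" if y: "y \<in> carrier X" for y
  proof -
    obtain l where l: "0 < l" "y [^]\<^bsub>X\<^esub> l \<in> Domain M"
      "\<And>r::nat. 0 < r \<Longrightarrow> r < l \<Longrightarrow> y [^]\<^bsub>X\<^esub> r \<notin> Domain M"
      using partial_character_graph_least_power[OF group_axioms M(1) \<open>0 < n\<close> exponent[OF y]] by blast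
    then obtain w where w: "(y [^]\<^bsub>X\<^esub> l, w) \<in> M" by blast
    then have "norm w = 1" using M(1) by (auto simp: partial_character_graph_def)
    then obtain v where v: "norm v = 1" "v ^ l = w" using circle_nth_root l(1) by blast
    \<comment> \<open>the extension of \<open>M\<close> to \<open>y\<close>, which must be \<open>M\<close> itself by maximality\<close>
    let ?M' = "{(a \<otimes>\<^bsub>X\<^esub> y [^]\<^bsub>X\<^esub> (k::nat), u * v ^ k) | a u k. (a, u) \<in> M}"
    have "partial_character_graph X ?M'"
      by (rule partial_character_graph_extend[where n = n and m = l])
        (use M l v w y assms in auto)
    moreover have "M \<subseteq> ?M'"
    proof clarify
      fix a u assume au: "(a, u) \<in> M"
      then have "a \<in> carrier X" using M(1) by (auto simp: partial_character_graph_def)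
      then show "\<exists>a' u' k. (a, u) = (a' \<otimes>\<^bsub>X\<^esub> y [^]\<^bsub>X\<^esub> (k::nat), u' * v ^ k) \<and> (a', u') \<in> M"
        using au by (intro exI[of _ a] exI[of _ u] exI[of _ "0::nat"]) auto
    qed
    ultimately have "?M' = M" by (rule maxM)
    moreover have "(y, v) \<in> ?M'"
      using M(1) y unfolding partial_character_graph_def
      by (intro CollectI exI[of _ "\<one>\<^bsub>X\<^esub>"] exI[of _ "1::complex"] exI[of _ "1::nat"]) auto
    ultimately show ?thesis by blast
  qed
  note unique = partial_character_graph_unique[OF group_axioms M(1) \<open>0 < n\<close> exponent]
  define \<phi> where "\<phi> = (\<lambda>y\<in>carrier X. SOME u. (y, u) \<in> M)"
  have graph: "(y, \<phi> y) \<in> M" if "y \<in> carrier X" for y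
    using total[OF that] that by (auto simp: \<phi>_def intro: someI_ex)
  have \<phi>_eq: "\<phi> y = u" if "(y, u) \<in> M" for y u
  proof -
    have "y \<in> carrier X" using that M(1) by (auto simp: partial_character_graph_def)
    from unique[OF _ graph[OF this] that] show ?thesis by blast
  qed
  show ?thesis
  proof
    have "norm (\<phi> y) = 1" if "y \<in> carrier X" for y
      using graph[OF that] M(1) by (auto simp: partial_character_graph_def)
    moreover have "\<phi> (a \<otimes>\<^bsub>X\<^esub> b) = \<phi> a * \<phi> b" if "a \<in> carrier X" "b \<in> carrier X" for a b
      using graph[OF that(1)] graph[OF that(2)] M(1)
      by (intro \<phi>_eq) (auto simp: partial_character_graph_def)
    ultimately show "\<phi> \<in> hom X circle_group"
      by (auto simp: hom_def circle_group_def)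
    show "\<phi> \<in> extensional (carrier X)" by (simp add: \<phi>_def)
    show "\<phi> b = 1" if "b \<in> B" for b using BR0[OF that] M(2) by (intro \<phi>_eq) auto
    show "\<phi> x \<noteq> 1" using \<phi>_eq[of x z] xR0 M(2) z(3) by auto
  qed
qed

section \<open>The character group\<close>

lemma abelian_topological_groupD:
  assumes "abelian_topological_group G T"
  shows "comm_group G" "group G" "topspace T = carrier G"
  using assms by (auto simp: abelian_topological_group_def topological_group_def)

lemma characters_iff:
  assumes "topspace T = carrier G"
  shows "\<xi> \<in> characters G T \<longleftrightarrow> \<xi> \<in> extensional (carrier G) \<and>
     (\<forall>x\<in>carrier G. norm (\<xi> x) = 1) \<and>
     (\<forall>x\<in>carrier G. \<forall>y\<in>carrier G. \<xi> (x \<otimes>\<^bsub>G\<^esub> y) = \<xi> x * \<xi> y) \<and>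
     continuous_map T euclidean \<xi>"
  using assms by (auto simp: characters_def hom_def circle_group_def continuous_map_in_subtopology Pi_iff)

lemma character_one:
  assumes "group G" "\<xi> \<in> characters G T"
  shows "\<xi> \<one>\<^bsub>G\<^esub> = 1"
proof -
  interpret group G by fact
  have *: "\<xi> \<in> hom G circle_group" using assms by (simp add: characters_def)
  have "\<xi> (\<one>\<^bsub>G\<^esub> \<otimes>\<^bsub>G\<^esub> \<one>\<^bsub>G\<^esub>) = \<xi> \<one>\<^bsub>G\<^esub> * \<xi> \<one>\<^bsub>G\<^esub>"
    using * one_closed unfolding hom_def circle_group_def by fastforce
  moreover have "norm (\<xi> \<one>\<^bsub>G\<^esub>) = 1"
    using * one_closed unfolding hom_def circle_group_def by fastforce
  ultimately show ?thesis by auto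
qed

lemma character_pow:
  assumes "group G" "\<xi> \<in> characters G T" "x \<in> carrier G"
  shows "\<xi> (x [^]\<^bsub>G\<^esub> (k::nat)) = \<xi> x ^ k"
proof -
  interpret group G by fact
  have "\<xi> (a \<otimes>\<^bsub>G\<^esub> b) = \<xi> a * \<xi> b" if "a \<in> carrier G" "b \<in> carrier G" for a b
    using assms that by (simp add: characters_def hom_def circle_group_def)
  then show ?thesis
    by (induction k) (use assms character_one[OF group_axioms assms(2)] in \<open>auto simp: mult.commute\<close>)
qed

lemma character_root_of_unity:
  assumes "group G" "\<And>x. x \<in> carrier G \<Longrightarrow> x [^]\<^bsub>G\<^esub> (n::nat) = \<one>\<^bsub>G\<^esub>"
    "\<xi> \<in> characters G T" "x \<in> carrier G"
  shows "\<xi> x ^ n = 1"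
  using character_pow[OF assms(1,3,4), of n] character_one[OF assms(1,3)] assms(2,4) by simp

lemma continuous_map_complex_mult:
  fixes f g :: "'a \<Rightarrow> complex"
  assumes "continuous_map T euclidean f" "continuous_map T euclidean g"
  shows "continuous_map T euclidean (\<lambda>x. f x * g x)"
proof -
  have "continuous_map T (prod_topology euclidean euclidean) (\<lambda>x. (f x, g x))"
    using assms by (intro continuous_map_pairedI)
  then have "continuous_map T euclidean (\<lambda>x. (f x, g x))"
    by (simp flip: euclidean_product_topology)
  moreover have "continuous_map euclidean euclidean (\<lambda>(x, y). x * y :: complex)"
    by (auto simp: case_prod_unfold intro!: continuous_intros)
  ultimately have "continuous_map T euclidean ((\<lambda>(x, y). x * y) \<circ> (\<lambda>x. (f x, g x)))"
    by (rule continuous_map_compose)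
  then show ?thesis by (simp add: o_def)
qed

lemma characters_mult:
  assumes "abelian_topological_group G T" "\<xi> \<in> characters G T" "\<psi> \<in> characters G T"
  shows "(\<lambda>x\<in>carrier G. \<xi> x * \<psi> x) \<in> characters G T"
proof -
  note G = abelian_topological_groupD[OF assms(1)]
  interpret comm_group G by (rule G)
  have "continuous_map T euclidean (\<lambda>x. \<xi> x * \<psi> x)"
    using assms by (intro continuous_map_complex_mult) (auto simp: characters_iff[OF G(3)])
  then have "continuous_map T euclidean (\<lambda>x\<in>carrier G. \<xi> x * \<psi> x)"
    by (rule continuous_map_eq) (simp add: G)
  then show ?thesis using assms by (auto simp: characters_iff[OF G(3)] norm_mult)
qed

lemma characters_trivial:
  assumes "abelian_topological_group G T"
  shows "(\<lambda>x\<in>carrier G. 1) \<in> characters G T"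
proof -
  note G = abelian_topological_groupD[OF assms(1)]
  interpret comm_group G by (rule G)
  have "continuous_map T euclidean (\<lambda>x\<in>carrier G. 1 :: complex)"
    by (rule continuous_map_eq[of _ _ "\<lambda>x. 1"]) (simp_all add: G)
  then show ?thesis by (auto simp: characters_iff[OF G(3)])
qed

lemma characters_power:
  assumes "abelian_topological_group G T" "\<xi> \<in> characters G T"
  shows "(\<lambda>x\<in>carrier G. \<xi> x ^ k) \<in> characters G T"
proof (induction k)
  case 0
  then show ?case unfolding power_0 by (rule characters_trivial[OF assms(1)])
next
  case (Suc k)
  have eq: "(\<lambda>x\<in>carrier G. \<xi> x ^ Suc k) = (\<lambda>x\<in>carrier G. \<xi> x * (\<lambda>x\<in>carrier G. \<xi> x ^ k) x)"
    by auto
  show ?case unfolding eq by (rule characters_mult[OF assms Suc])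
qed

lemma characters_inverse:
  assumes "abelian_topological_group G T" "\<xi> \<in> characters G T"
  shows "(\<lambda>x\<in>carrier G. cnj (\<xi> x)) \<in> characters G T"
proof -
  note G = abelian_topological_groupD[OF assms(1)]
  interpret comm_group G by (rule G)
  have "continuous_map T euclidean (cnj \<circ> \<xi>)"
    using assms by (intro continuous_map_compose[of _ euclidean])
      (auto simp: characters_iff[OF G(3)] intro: continuous_intros)
  then have "continuous_map T euclidean (\<lambda>x\<in>carrier G. cnj (\<xi> x))"
    by (rule continuous_map_eq) (simp add: G)
  then show ?thesis using assms by (auto simp: characters_iff[OF G(3)])
qed

lemma comm_group_dual_group:
  assumes "abelian_topological_group G T"
  shows "comm_group (dual_group G T)"
proof (rule comm_groupI)
  note G = abelian_topological_groupD[OF assms(1)]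
  interpret comm_group G by (rule G)
  fix \<xi> assume \<xi>: "\<xi> \<in> carrier (dual_group G T)"
  then have "\<xi> \<in> extensional (carrier G)" by (simp add: dual_group_def characters_def)
  then show "\<one>\<^bsub>dual_group G T\<^esub> \<otimes>\<^bsub>dual_group G T\<^esub> \<xi> = \<xi>"
    by (auto simp: dual_group_def extensional_def restrict_def fun_eq_iff)
  have "cnj (\<xi> x) * \<xi> x = 1" if "x \<in> carrier G" for x
    using \<xi> that by (simp add: dual_group_def characters_iff[OF G(3)] complex_norm_square[symmetric] mult.commute)
  then show "\<exists>\<psi>\<in>carrier (dual_group G T). \<psi> \<otimes>\<^bsub>dual_group G T\<^esub> \<xi> = \<one>\<^bsub>dual_group G T\<^esub>"
    using \<xi> characters_inverse[OF assms]
    by (intro bexI[of _ "\<lambda>x\<in>carrier G. cnj (\<xi> x)"]) (auto simp: dual_group_def)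
qed (use assms in \<open>auto simp: dual_group_def characters_mult characters_trivial mult_ac
  abelian_topological_groupD comm_group.axioms intro!: restrict_ext dest: abelian_topological_groupD(2)\<close>)

lemma dual_group_pow:
  "\<xi> \<in> extensional (carrier G) \<Longrightarrow> \<xi> [^]\<^bsub>dual_group G T\<^esub> (k::nat) = (\<lambda>x\<in>carrier G. \<xi> x ^ k)"
proof (induction k)
  case 0
  then show ?case by (simp add: nat_pow_def dual_group_def)
next
  case (Suc k)
  then show ?case by (auto simp: nat_pow_def dual_group_def mult.commute)
qed

lemma dual_group_exponent:
  assumes "group G" "\<And>x. x \<in> carrier G \<Longrightarrow> x [^]\<^bsub>G\<^esub> (n::nat) = \<one>\<^bsub>G\<^esub>"
    "\<xi> \<in> carrier (dual_group G T)"
  shows "\<xi> [^]\<^bsub>dual_group G T\<^esub> n = \<one>\<^bsub>dual_group G T\<^esub>"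
proof -
  have \<xi>: "\<xi> \<in> characters G T" using assms by (simp add: dual_group_def)
  then have "\<xi> \<in> extensional (carrier G)" by (simp add: characters_def)
  then show ?thesis
    using character_root_of_unity[OF assms(1,2) \<xi>] by (auto simp: dual_group_pow) (auto simp: dual_group_def)
qed

section \<open>Translations and open subgroups\<close>

lemma continuous_map_translation:
  assumes "abelian_topological_group G T" "a \<in> carrier G"
  shows "continuous_map T T (\<lambda>x. a \<otimes>\<^bsub>G\<^esub> x)"
proof -
  have "continuous_map (prod_topology T T) T (\<lambda>(x, y). x \<otimes>\<^bsub>G\<^esub> y)" "topspace T = carrier G"
    using assms by (auto simp: abelian_topological_group_def topological_group_def)
  moreover have "continuous_map T (prod_topology T T) (\<lambda>x. (a, x))"
    using assms calculation by (intro continuous_map_pairedI) auto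
  ultimately have "continuous_map T T ((\<lambda>(x, y). x \<otimes>\<^bsub>G\<^esub> y) \<circ> (\<lambda>x. (a, x)))"
    using continuous_map_compose by blast
  then show ?thesis by (simp add: o_def)
qed

lemma continuous_map_group_power:
  assumes "abelian_topological_group G T"
  shows "continuous_map T T (\<lambda>x. x [^]\<^bsub>G\<^esub> (k::nat))"
proof (induction k)
  case 0
  have "\<one>\<^bsub>G\<^esub> \<in> topspace T"
    using abelian_topological_groupD[OF assms] by (simp add: group.is_monoid)
  then show ?case by (simp add: nat_pow_def)
next
  case (Suc k)
  have "continuous_map (prod_topology T T) T (\<lambda>(x, y). x \<otimes>\<^bsub>G\<^esub> y)"
    using assms by (auto simp: abelian_topological_group_def topological_group_def)
  moreover have "continuous_map T (prod_topology T T) (\<lambda>x. (x [^]\<^bsub>G\<^esub> k, x))"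
    using Suc by (intro continuous_map_pairedI) auto
  ultimately have "continuous_map T T ((\<lambda>(x, y). x \<otimes>\<^bsub>G\<^esub> y) \<circ> (\<lambda>x. (x [^]\<^bsub>G\<^esub> k, x)))"
    using continuous_map_compose by blast
  then show ?case by (simp add: o_def nat_pow_def)
qed

text \<open>
  The cases of interest are a subgroup \<open>U\<close> containing \<open>W\<close>, and a union \<open>U\<close> of cosets of an open subgroup
  \<open>W\<close>, such as a preimage under a homomorphism trivial on \<open>W\<close>.
\<close>
lemma openin_of_subgroup_neighbourhood:
  assumes G: "abelian_topological_group G T" and U: "U \<subseteq> carrier G"
    and W: "openin T W" "\<one>\<^bsub>G\<^esub> \<in> W" and UW: "\<And>u w. u \<in> U \<Longrightarrow> w \<in> W \<Longrightarrow> u \<otimes>\<^bsub>G\<^esub> w \<in> U"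
  shows "openin T U"
proof (subst openin_subopen, intro ballI)
  note G' = abelian_topological_groupD[OF G]
  interpret comm_group G by (rule G')
  fix u assume u: "u \<in> U"
  then have uG: "u \<in> carrier G" using U by blast
  let ?V = "{x \<in> topspace T. inv\<^bsub>G\<^esub> u \<otimes>\<^bsub>G\<^esub> x \<in> W}"
  have "openin T ?V"
    using W(1) uG by (intro openin_continuous_map_preimage[OF continuous_map_translation[OF G]]) auto
  moreover have "u \<in> ?V" using uG W(2) G' by auto
  moreover have "?V \<subseteq> U"
  proof
    fix x assume x: "x \<in> ?V"
    then have "u \<otimes>\<^bsub>G\<^esub> (inv\<^bsub>G\<^esub> u \<otimes>\<^bsub>G\<^esub> x) \<in> U" using UW u by blast
    moreover have "u \<otimes>\<^bsub>G\<^esub> (inv\<^bsub>G\<^esub> u \<otimes>\<^bsub>G\<^esub> x) = x"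
      using uG x G'(3) by (simp flip: m_assoc)
    ultimately show "x \<in> U" by simp
  qed
  ultimately show "\<exists>V. openin T V \<and> u \<in> V \<and> V \<subseteq> U" by blast
qed

lemma character_if_trivial_on_open:
  assumes G: "abelian_topological_group G T" and H: "openin T H" "\<one>\<^bsub>G\<^esub> \<in> H"
    and f: "f \<in> extensional (carrier G)" "\<And>x. x \<in> carrier G \<Longrightarrow> norm (f x) = 1"
      "\<And>x y. x \<in> carrier G \<Longrightarrow> y \<in> carrier G \<Longrightarrow> f (x \<otimes>\<^bsub>G\<^esub> y) = f x * f y"
      "\<And>h. h \<in> H \<Longrightarrow> f h = 1"
  shows "f \<in> characters G T"
proof -
  note G' = abelian_topological_groupD[OF G]
  interpret comm_group G by (rule G')
  have HG: "H \<subseteq> carrier G" using openin_subset[OF H(1)] G' by simp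
  have "openin T {x \<in> topspace T. f x \<in> U}" for U
    by (rule openin_of_subgroup_neighbourhood[OF G _ H]) (use HG f G' in auto)
  then have "continuous_map T euclidean f" by (auto simp: continuous_map_def)
  then show ?thesis using f by (simp add: characters_iff[OF G'(3)])
qed

section \<open>The compact-open topology on the dual of a bounded group\<close>

text \<open>
  In each subbasic neighbourhood the compact set can be kept and the condition on values strengthened
  to equality; finite intersections correspond to finite unions of compact sets.
\<close>
lemma dual_topology_nhd:
  assumes "topspace T = carrier G" "openin (dual_topology G T) W" "\<xi>\<^sub>0 \<in> W"
  obtains C where "compactin T C" "{\<xi> \<in> characters G T. \<forall>c\<in>C. \<xi> c = \<xi>\<^sub>0 c} \<subseteq> W"
proof -
  have *: "\<forall>\<xi>\<^sub>0\<in>V. \<exists>C. compactin T C \<and> {\<xi> \<in> characters G T. \<forall>c\<in>C. \<xi> c = \<xi>\<^sub>0 c} \<subseteq> V"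
    if "generate_topology_on {{f \<in> extensional (topspace T). continuous_map T circle_topology f \<and> f ` K \<subseteq> U} | K U.
          compactin T K \<and> openin circle_topology U} V" for V
    using that
  proof induction
    case Empty
    then show ?case by simp
  next
    case (Int a b)
    show ?case
    proof
      fix \<xi>\<^sub>0 assume "\<xi>\<^sub>0 \<in> a \<inter> b"
      then obtain C D where "compactin T C" "{\<xi> \<in> characters G T. \<forall>c\<in>C. \<xi> c = \<xi>\<^sub>0 c} \<subseteq> a"
        "compactin T D" "{\<xi> \<in> characters G T. \<forall>c\<in>D. \<xi> c = \<xi>\<^sub>0 c} \<subseteq> b"
        using Int by (meson IntD1 IntD2)
      then show "\<exists>C. compactin T C \<and> {\<xi> \<in> characters G T. \<forall>c\<in>C. \<xi> c = \<xi>\<^sub>0 c} \<subseteq> a \<inter> b"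
        by (intro exI[of _ "C \<union> D"]) (auto intro: compactin_Un)
    qed
  next
    case (UN \<K>)
    then show ?case by (meson Sup_upper UnionE order_trans)
  next
    case (Basis s)
    then obtain K U where s: "s = {f \<in> extensional (topspace T). continuous_map T circle_topology f \<and> f ` K \<subseteq> U}"
      "compactin T K" by blast
    show ?case
    proof
      fix \<xi>\<^sub>0 assume "\<xi>\<^sub>0 \<in> s"
      then have "{\<xi> \<in> characters G T. \<forall>c\<in>K. \<xi> c = \<xi>\<^sub>0 c} \<subseteq> s"
        using assms(1) by (auto simp: s characters_def image_subset_iff)
      then show "\<exists>C. compactin T C \<and> {\<xi> \<in> characters G T. \<forall>c\<in>C. \<xi> c = \<xi>\<^sub>0 c} \<subseteq> s"
        using s(2) by blast
    qed
  qed
  from assms(2) obtain V where V: "openin (compact_open_topology T circle_topology) V" "W = V \<inter> characters G T"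
    by (auto simp: dual_topology_def openin_subtopology)
  with assms(3) * obtain C where "compactin T C" "{\<xi> \<in> characters G T. \<forall>c\<in>C. \<xi> c = \<xi>\<^sub>0 c} \<subseteq> V"
    unfolding compact_open_topology_def openin_topology_generated_by_iff by (meson IntD1)
  then show ?thesis using that V by blast
qed

text \<open>
  Conversely, since the values are roots of unity, \<open>C\<close> splits into the finitely many compact pieces on
  which the given character is constant, and the value on each piece is isolated among the roots of
  unity. Together with the preceding lemma: agreement on compact sets describes the topology.
\<close>
lemma openin_dual_topology_agree:
  assumes G: "topspace T = carrier G" and "0 < n"
    and root: "\<And>\<xi> x. \<xi> \<in> characters G T \<Longrightarrow> x \<in> carrier G \<Longrightarrow> \<xi> x ^ n = 1"
    and C: "compactin T C" and \<xi>\<^sub>0: "\<xi>\<^sub>0 \<in> characters G T"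
  shows "openin (dual_topology G T) {\<xi> \<in> characters G T. \<forall>c\<in>C. \<xi> c = \<xi>\<^sub>0 c}"
proof -
  define Z where "Z = {z::complex. z ^ n = 1}"
  have Z: "finite Z" "1 \<in> Z" using \<open>0 < n\<close> by (auto simp: Z_def finite_roots_unity)
  have CG: "C \<subseteq> carrier G" using compactin_subset_topspace[OF C] G by simp
  define B where "B \<zeta> = {f \<in> extensional (topspace T). continuous_map T circle_topology f \<and>
      f ` (C \<inter> {x \<in> topspace T. \<xi>\<^sub>0 x \<in> {\<zeta>}}) \<subseteq> sphere 0 1 \<inter> - (Z - {\<zeta>})}" for \<zeta>
  \<comment> \<open>\<open>C\<close> itself need not be closed, but its intersection with a closed set is compact\<close>
  have "openin (compact_open_topology T circle_topology) (B \<zeta>)" for \<zeta>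
  proof -
    have "closedin T {x \<in> topspace T. \<xi>\<^sub>0 x \<in> {\<zeta>}}"
      using \<xi>\<^sub>0 by (intro closedin_continuous_map_preimage[of _ euclidean]) (auto simp: characters_iff[OF G])
    with C have "compactin T (C \<inter> {x \<in> topspace T. \<xi>\<^sub>0 x \<in> {\<zeta>}})"
      by (rule compact_Int_closedin)
    moreover have "openin circle_topology (sphere 0 1 \<inter> - (Z - {\<zeta>}))"
      using Z by (intro openin_open_Int open_Compl finite_imp_closed) auto
    ultimately show ?thesis
      unfolding compact_open_topology_def B_def by (intro topology_generated_by_Basis) blast
  qed
  then have "openin (compact_open_topology T circle_topology) (\<Inter>\<zeta>\<in>Z. B \<zeta>)"
    using Z by (intro openin_INT2) auto
  then have "openin (dual_topology G T) ((\<Inter>\<zeta>\<in>Z. B \<zeta>) \<inter> characters G T)"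
    unfolding dual_topology_def openin_subtopology by blast
  moreover have "(\<Inter>\<zeta>\<in>Z. B \<zeta>) \<inter> characters G T = {\<xi> \<in> characters G T. \<forall>c\<in>C. \<xi> c = \<xi>\<^sub>0 c}" (is "?L = ?R")
  proof
    show "?L \<subseteq> ?R"
    proof
      fix \<xi> assume \<xi>: "\<xi> \<in> ?L"
      have "\<xi> c = \<xi>\<^sub>0 c" if "c \<in> C" for c
      proof -
        have c: "c \<in> carrier G" using that CG by blast
        have "\<xi>\<^sub>0 c \<in> Z" "\<xi> c \<in> Z" using root \<xi>\<^sub>0 \<xi> c by (auto simp: Z_def)
        moreover have "\<xi> c \<notin> Z - {\<xi>\<^sub>0 c}"
          using \<xi> \<open>\<xi>\<^sub>0 c \<in> Z\<close> that c G by (auto simp: B_def image_subset_iff)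
        ultimately show ?thesis by blast
      qed
      then show "\<xi> \<in> ?R" using \<xi> by blast
    qed
    show "?R \<subseteq> ?L"
      using CG G by (auto simp: B_def characters_def circle_group_def hom_def)
  qed
  ultimately show ?thesis by simp
qed

section \<open>Locally quasi-convex groups of finite exponent\<close>

text \<open>
  A character with a value other than \<open>1\<close> at \<open>g\<close> need not leave the right half circle there, but one of
  its powers does, and powers stay trivial on the annihilator.
\<close>
lemma quasi_convex_annihilator:
  assumes G: "abelian_topological_group G T" and "0 < n"
    and exponent: "\<And>x. x \<in> carrier G \<Longrightarrow> x [^]\<^bsub>G\<^esub> (n::nat) = \<one>\<^bsub>G\<^esub>"
    and "S \<subseteq> characters G T"
  shows "quasi_convex G T {g \<in> carrier G. \<forall>\<xi>\<in>S. \<xi> g = 1}"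
  unfolding quasi_convex_def
proof (intro conjI ballI)
  note G' = abelian_topological_groupD[OF G]
  fix g assume "g \<in> carrier G - {g \<in> carrier G. \<forall>\<xi>\<in>S. \<xi> g = 1}"
  then obtain \<xi> where g: "g \<in> carrier G" and \<xi>: "\<xi> \<in> S" "\<xi> g \<noteq> 1" by blast
  have \<xi>': "\<xi> \<in> characters G T" using assms \<xi> by blast
  have "\<xi> g ^ n = 1" using character_root_of_unity[OF G'(2) exponent \<xi>' g] .
  then obtain m where m: "\<not> 0 \<le> Re (\<xi> g ^ m)"
    using root_of_unity_eq_1 \<open>0 < n\<close> \<xi>(2) by blast
  show "\<exists>\<phi>\<in>characters G T. \<phi> g \<notin> circle_plus \<and> \<phi> ` {g \<in> carrier G. \<forall>\<xi>\<in>S. \<xi> g = 1} \<subseteq> circle_plus"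
  proof (intro bexI conjI)
    show "(\<lambda>x\<in>carrier G. \<xi> x ^ m) \<in> characters G T" by (rule characters_power[OF G \<xi>'])
  qed (use m g \<xi> in \<open>auto simp: circle_plus_def\<close>)
qed auto

text \<open>
  Take \<open>S\<close> to be the polar of a quasi-convex neighbourhood \<open>Q\<close>. Its annihilator lies in \<open>Q\<close> by
  quasi-convexity. It is open because on elements whose first \<open>n\<close> powers stay in \<open>Q\<close> the characters
  in \<open>S\<close> have all powers in the right half circle, hence are trivial.
\<close>
lemma locally_quasi_convex_imp_linear:
  assumes N: "abelian_topological_group G N" and lqc: "locally_quasi_convex G N" and n: "0 < n"
    and exponent: "\<And>x. x \<in> carrier G \<Longrightarrow> x [^]\<^bsub>G\<^esub> (n::nat) = \<one>\<^bsub>G\<^esub>"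
    and U: "openin N U" "\<one>\<^bsub>G\<^esub> \<in> U"
  obtains S where "S \<subseteq> characters G N" "openin N {g \<in> carrier G. \<forall>\<xi>\<in>S. \<xi> g = 1}"
    "{g \<in> carrier G. \<forall>\<xi>\<in>S. \<xi> g = 1} \<subseteq> U"
proof -
  note G' = abelian_topological_groupD[OF N]
  interpret comm_group G by (rule G')
  obtain V Q where VQ: "openin N V" "quasi_convex G N Q" "\<one>\<^bsub>G\<^esub> \<in> V" "V \<subseteq> Q" "Q \<subseteq> U"
    using lqc U unfolding locally_quasi_convex_def neighbourhood_base_at_def by meson
  define S where "S = {\<xi> \<in> characters G N. \<xi> ` Q \<subseteq> circle_plus}"
  define W where "W = (\<Inter>m<n. {x \<in> topspace N. x [^]\<^bsub>G\<^esub> m \<in> V})"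
  have SX: "S \<subseteq> characters G N" by (auto simp: S_def)
  have "openin N W"
    unfolding W_def using n VQ(1)
    by (intro openin_INT2 openin_continuous_map_preimage[OF continuous_map_group_power[OF N]]) auto
  moreover have "\<one>\<^bsub>G\<^esub> \<in> W" using VQ(3) G' by (auto simp: W_def)
  moreover have WS: "\<xi> w = 1" if w: "w \<in> W" and \<xi>: "\<xi> \<in> S" for w \<xi>
  proof (rule root_of_unity_eq_1[OF _ n])
    have wG: "w \<in> carrier G" using w n G' by (auto simp: W_def)
    show "\<xi> w ^ n = 1" using \<xi> SX wG by (intro character_root_of_unity[OF G'(2) exponent]) auto
    fix m assume "m < n"
    then have "w [^]\<^bsub>G\<^esub> m \<in> Q" using w VQ(4) by (auto simp: W_def)
    then have "\<xi> (w [^]\<^bsub>G\<^esub> m) \<in> circle_plus" using \<xi> by (auto simp: S_def)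
    moreover have "\<xi> (w [^]\<^bsub>G\<^esub> m) = \<xi> w ^ m" using \<xi> SX wG by (intro character_pow[OF G'(2)]) auto
    ultimately show "0 \<le> Re (\<xi> w ^ m)" by (simp add: circle_plus_def)
  qed
  ultimately have "openin N {g \<in> carrier G. \<forall>\<xi>\<in>S. \<xi> g = 1}"
  proof (rule_tac openin_of_subgroup_neighbourhood[OF N, of _ W])
    fix g w assume gw: "g \<in> {g \<in> carrier G. \<forall>\<xi>\<in>S. \<xi> g = 1}" "w \<in> W"
    then have wG: "w \<in> carrier G" using n G' by (auto simp: W_def)
    have "\<xi> (g \<otimes>\<^bsub>G\<^esub> w) = 1" if "\<xi> \<in> S" for \<xi>
      using that gw wG SX WS[OF gw(2) that] by (auto simp: characters_iff[OF G'(3)] subset_iff)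
    then show "g \<otimes>\<^bsub>G\<^esub> w \<in> {g \<in> carrier G. \<forall>\<xi>\<in>S. \<xi> g = 1}" using gw wG by auto
  qed auto
  moreover have "{g \<in> carrier G. \<forall>\<xi>\<in>S. \<xi> g = 1} \<subseteq> Q"
  proof (rule ccontr)
    assume "\<not> ?thesis"
    then obtain g where g: "g \<in> carrier G - Q" "\<forall>\<xi>\<in>S. \<xi> g = 1" by blast
    then obtain \<xi> where "\<xi> \<in> S" "\<xi> g \<notin> circle_plus"
      using VQ(2) unfolding quasi_convex_def S_def by blast
    then show False using g(2) by (auto simp: circle_plus_def)
  qed
  ultimately show ?thesis using that SX VQ(5) by blast
qed

section \<open>Polarity in reflexive groups\<close>

text \<open>
  The annihilator of \<open>C\<close> is the preimage, under the canonical map, of the characters of the dual group that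
  agree on \<open>C\<close> with the trivial one. These form an open set, since the dual group has the same exponent.
\<close>
lemma reflexive_group_openin_annihilator:
  assumes G: "abelian_topological_group G T" and "reflexive_group G T" and "0 < n"
    and exponent: "\<And>x. x \<in> carrier G \<Longrightarrow> x [^]\<^bsub>G\<^esub> (n::nat) = \<one>\<^bsub>G\<^esub>"
    and C: "compactin (dual_topology G T) C"
  shows "openin T {g \<in> carrier G. \<forall>\<xi>\<in>C. \<xi> g = 1}"
proof -
  note G' = abelian_topological_groupD[OF G]
  interpret D: comm_group "dual_group G T" by (rule comm_group_dual_group[OF G])
  have top: "topspace (dual_topology G T) = carrier (dual_group G T)"
    by (rule topspace_dual_topology[OF G'(3)])
  have CX: "C \<subseteq> characters G T"
    using compactin_subset_topspace[OF C] top by (simp add: dual_group_def)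
  have canonical: "continuous_map T (bidual_topology G T) (canonical_hom G T)"
    using assms(2) by (simp add: reflexive_group_def homeomorphic_imp_continuous_map)
  have bidual: "canonical_hom G T g \<in> characters (dual_group G T) (dual_topology G T)" if "g \<in> carrier G" for g
    using assms(2) that by (auto simp: reflexive_group_def iso_def hom_def bidual_group_def dual_group_def Pi_iff)
  define \<phi>\<^sub>0 where "\<phi>\<^sub>0 = canonical_hom G T \<one>\<^bsub>G\<^esub>"
  have one: "\<one>\<^bsub>G\<^esub> \<in> carrier G" using G'(2) by (simp add: group.is_monoid)
  have \<phi>\<^sub>0: "\<phi>\<^sub>0 \<xi> = 1" if "\<xi> \<in> C" for \<xi>
    using that CX character_one[OF G'(2)] by (auto simp: \<phi>\<^sub>0_def canonical_hom_def)
  have "openin (bidual_topology G T)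
    {\<phi> \<in> characters (dual_group G T) (dual_topology G T). \<forall>\<xi>\<in>C. \<phi> \<xi> = \<phi>\<^sub>0 \<xi>}"
    unfolding bidual_topology_def
  proof (rule openin_dual_topology_agree[OF top \<open>0 < n\<close> _ C])
    show "\<phi> x ^ n = 1" if "\<phi> \<in> characters (dual_group G T) (dual_topology G T)"
      "x \<in> carrier (dual_group G T)" for \<phi> x
      using character_root_of_unity[OF D.group_axioms _ that] dual_group_exponent[OF G'(2) exponent] by blast
    show "\<phi>\<^sub>0 \<in> characters (dual_group G T) (dual_topology G T)"
      using bidual[OF one] by (simp add: \<phi>\<^sub>0_def)
  qed
  from openin_continuous_map_preimage[OF canonical this]
  have "openin T {g \<in> topspace T. canonical_hom G T g \<in>
    {\<phi> \<in> characters (dual_group G T) (dual_topology G T). \<forall>\<xi>\<in>C. \<phi> \<xi> = \<phi>\<^sub>0 \<xi>}}" .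
  also have "{g \<in> topspace T. canonical_hom G T g \<in>
    {\<phi> \<in> characters (dual_group G T) (dual_topology G T). \<forall>\<xi>\<in>C. \<phi> \<xi> = \<phi>\<^sub>0 \<xi>}}
    = {g \<in> carrier G. \<forall>\<xi>\<in>C. \<xi> g = 1}"
    using bidual CX \<phi>\<^sub>0 by (auto simp: G'(3) canonical_hom_def subset_iff)
  finally show ?thesis .
qed

text \<open>
  The complement to the preceding lemma, from openness of the canonical map: annihilators of compact
  sets of characters form a neighbourhood base at the identity.
\<close>
lemma reflexive_group_annihilator_subset:
  assumes G: "abelian_topological_group G T" and refl: "reflexive_group G T"
    and U: "openin T U" "\<one>\<^bsub>G\<^esub> \<in> U"
  obtains C where "compactin (dual_topology G T) C" "{g \<in> carrier G. \<forall>\<xi>\<in>C. \<xi> g = 1} \<subseteq> U"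
proof -
  note G' = abelian_topological_groupD[OF G]
  have top: "topspace (dual_topology G T) = carrier (dual_group G T)"
    by (rule topspace_dual_topology[OF G'(3)])
  have UG: "U \<subseteq> carrier G" using openin_subset[OF U(1)] G' by simp
  have inj: "inj_on (canonical_hom G T) (carrier G)"
    and bidual: "canonical_hom G T g \<in> characters (dual_group G T) (dual_topology G T)" if "g \<in> carrier G" for g
    using refl that by (auto simp: reflexive_group_def iso_def hom_def bidual_group_def dual_group_def Pi_iff bij_betw_def)
  have "openin (bidual_topology G T) (canonical_hom G T ` U)"
    using refl U by (auto simp: reflexive_group_def dest!: homeomorphic_imp_open_map simp: open_map_def)
  then obtain C where C: "compactin (dual_topology G T) C"
    "{\<phi> \<in> characters (dual_group G T) (dual_topology G T). \<forall>\<xi>\<in>C. \<phi> \<xi> = canonical_hom G T \<one>\<^bsub>G\<^esub> \<xi>}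
      \<subseteq> canonical_hom G T ` U"
    unfolding bidual_topology_def using U(2) by (auto elim!: dual_topology_nhd[OF top])
  have CX: "C \<subseteq> characters G T"
    using compactin_subset_topspace[OF C(1)] top by (simp add: dual_group_def)
  have "g \<in> U" if g: "g \<in> carrier G" "\<forall>\<xi>\<in>C. \<xi> g = 1" for g
  proof -
    have "canonical_hom G T g \<xi> = canonical_hom G T \<one>\<^bsub>G\<^esub> \<xi>" if "\<xi> \<in> C" for \<xi>
      using that g(2) CX character_one[OF G'(2)] by (auto simp: canonical_hom_def)
    then have "canonical_hom G T g \<in> canonical_hom G T ` U" using C(2) bidual[OF g(1)] by blast
    then show ?thesis using inj[OF g(1)] g(1) UG by (auto simp: inj_on_def)
  qed
  then show ?thesis using that C(1) by blast
qed

lemma reflexive_group_imp_locally_quasi_convex: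
  assumes G: "abelian_topological_group G T" and refl: "reflexive_group G T" and n: "0 < n"
    and exponent: "\<And>x. x \<in> carrier G \<Longrightarrow> x [^]\<^bsub>G\<^esub> (n::nat) = \<one>\<^bsub>G\<^esub>"
  shows "locally_quasi_convex G T"
  unfolding locally_quasi_convex_def
proof
  note G' = abelian_topological_groupD[OF G]
  have inj: "inj_on (canonical_hom G T) (carrier G)"
    using refl by (auto simp: reflexive_group_def iso_def bij_betw_def)
  show "maximally_almost_periodic G T"
    unfolding maximally_almost_periodic_def
  proof (intro ballI impI)
    fix g h assume gh: "g \<in> carrier G" "h \<in> carrier G" "g \<noteq> h"
    then have "canonical_hom G T g \<noteq> canonical_hom G T h" using inj by (auto simp: inj_on_def)
    then show "\<exists>\<phi>\<in>characters G T. \<phi> g \<noteq> \<phi> h"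
      unfolding canonical_hom_def by (meson restrict_ext)
  qed
  show "neighbourhood_base_at \<one>\<^bsub>G\<^esub> (quasi_convex G T) T"
    unfolding neighbourhood_base_at_def
  proof (intro allI impI, elim conjE)
    fix W assume W: "openin T W" "\<one>\<^bsub>G\<^esub> \<in> W"
    then obtain C where C: "compactin (dual_topology G T) C" "{g \<in> carrier G. \<forall>\<xi>\<in>C. \<xi> g = 1} \<subseteq> W"
      using reflexive_group_annihilator_subset[OF G refl] by blast
    have CX: "C \<subseteq> characters G T"
      using compactin_subset_topspace[OF C(1)] topspace_dual_topology[OF G'(3)] by (simp add: dual_group_def)
    have "openin T {g \<in> carrier G. \<forall>\<xi>\<in>C. \<xi> g = 1}"
      by (rule reflexive_group_openin_annihilator[OF G refl n exponent C(1)])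
    moreover have "quasi_convex G T {g \<in> carrier G. \<forall>\<xi>\<in>C. \<xi> g = 1}"
      by (rule quasi_convex_annihilator[OF G n exponent CX])
    moreover have "\<one>\<^bsub>G\<^esub> \<in> {g \<in> carrier G. \<forall>\<xi>\<in>C. \<xi> g = 1}"
      using CX character_one[OF G'(2)] W openin_subset[OF W(1)] G'(3) by auto
    ultimately show "\<exists>U V. openin T U \<and> quasi_convex G T V \<and> \<one>\<^bsub>G\<^esub> \<in> U \<and> U \<subseteq> V \<and> V \<subseteq> W"
      using C(2) by blast
  qed
qed

text \<open>
  Submonoids \<open>D\<close> of the dual group that are open, i.e. contain all characters trivial on some compact \<open>C\<close>,
  are closed for pointwise convergence. Algebraically, some homomorphism on the dual group is trivial
  on \<open>D\<close> but not at the given character. It is locally constant because \<open>D\<close> is open, hence continuous,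
  and surjectivity of the canonical map makes it the evaluation at a point of the group.
\<close>
lemma reflexive_group_separating_element:
  assumes G: "abelian_topological_group G T" and refl: "reflexive_group G T" and n: "0 < n"
    and exponent: "\<And>x. x \<in> carrier G \<Longrightarrow> x [^]\<^bsub>G\<^esub> (n::nat) = \<one>\<^bsub>G\<^esub>"
    and C: "compactin T C"
    and D: "D \<subseteq> characters G T" "(\<lambda>x\<in>carrier G. 1) \<in> D"
      "\<And>\<xi> \<eta>. \<xi> \<in> D \<Longrightarrow> \<eta> \<in> D \<Longrightarrow> (\<lambda>x\<in>carrier G. \<xi> x * \<eta> x) \<in> D"
    and sat: "\<And>\<xi>. \<xi> \<in> characters G T \<Longrightarrow> \<forall>c\<in>C. \<xi> c = 1 \<Longrightarrow> \<xi> \<in> D"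
    and \<xi>\<^sub>0: "\<xi>\<^sub>0 \<in> characters G T" "\<xi>\<^sub>0 \<notin> D"
  obtains g where "g \<in> carrier G" "\<And>\<xi>. \<xi> \<in> D \<Longrightarrow> \<xi> g = 1" "\<xi>\<^sub>0 g \<noteq> 1"
proof -
  note G' = abelian_topological_groupD[OF G]
  let ?X = "dual_group G T"
  have top: "topspace (dual_topology G T) = carrier ?X"
    by (rule topspace_dual_topology[OF G'(3)])
  have X: "carrier ?X = characters G T" by (simp add: dual_group_def)
  have CG: "C \<subseteq> carrier G" using compactin_subset_topspace[OF C] G' by simp
  obtain \<phi> where \<phi>: "\<phi> \<in> hom ?X circle_group" "\<phi> \<in> extensional (carrier ?X)"
    "\<And>b. b \<in> D \<Longrightarrow> \<phi> b = 1" "\<phi> \<xi>\<^sub>0 \<noteq> 1"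
    by (rule character_separating_submonoid[OF comm_group_dual_group[OF G] n dual_group_exponent[OF G'(2) exponent],
          of D \<xi>\<^sub>0])
      (use D \<xi>\<^sub>0 in \<open>auto simp: dual_group_def\<close>)
  have \<phi>_mult: "\<phi> (\<lambda>x\<in>carrier G. \<xi> x * \<eta> x) = \<phi> \<xi> * \<phi> \<eta>"
    if "\<xi> \<in> characters G T" "\<eta> \<in> characters G T" for \<xi> \<eta>
    using \<phi>(1) that by (simp add: hom_def dual_group_def circle_group_def)
  have local_const: "\<phi> \<xi> = \<phi> \<eta>"
    if \<xi>: "\<xi> \<in> characters G T" and \<eta>: "\<eta> \<in> characters G T" and eq: "\<forall>c\<in>C. \<xi> c = \<eta> c" for \<xi> \<eta>
  proof -
    \<comment> \<open>the quotient of the two characters is trivial on \<open>C\<close>, hence belongs to \<open>D\<close>\<close>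
    let ?d = "\<lambda>x\<in>carrier G. \<xi> x * (\<lambda>x\<in>carrier G. cnj (\<eta> x)) x"
    have unit: "\<eta> x * cnj (\<eta> x) = 1" if "x \<in> carrier G" for x
      using \<eta> that by (simp add: characters_iff[OF G'(3)] complex_norm_square[symmetric])
    have d: "?d \<in> characters G T"
      by (intro characters_mult characters_inverse G \<xi> \<eta>)
    moreover have "\<forall>c\<in>C. ?d c = 1" using eq CG unit by auto
    ultimately have "\<phi> ?d = 1" using sat \<phi>(3) by blast
    have "\<xi> = (\<lambda>x\<in>carrier G. ?d x * \<eta> x)"
    proof
      fix x
      have "\<xi> x = \<xi> x * (\<eta> x * cnj (\<eta> x))" if "x \<in> carrier G" using unit[OF that] by simp
      moreover have "\<xi> x = undefined" if "x \<notin> carrier G"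
        using \<xi> that by (auto simp: characters_def extensional_def)
      ultimately show "\<xi> x = (\<lambda>x\<in>carrier G. ?d x * \<eta> x) x" by (simp add: mult_ac)
    qed
    then show ?thesis using \<phi>_mult[OF d \<eta>] \<open>\<phi> ?d = 1\<close> by simp
  qed
  have "openin (dual_topology G T) {\<xi> \<in> topspace (dual_topology G T). \<phi> \<xi> \<in> U}" for U
  proof (subst openin_subopen, intro ballI)
    fix \<eta> assume "\<eta> \<in> {\<xi> \<in> topspace (dual_topology G T). \<phi> \<xi> \<in> U}"
    then have \<eta>: "\<eta> \<in> characters G T" "\<phi> \<eta> \<in> U" by (auto simp: top X)
    have "openin (dual_topology G T) {\<xi> \<in> characters G T. \<forall>c\<in>C. \<xi> c = \<eta> c}"
      by (rule openin_dual_topology_agree[OF G'(3) n _ C \<eta>(1)])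
        (rule character_root_of_unity[OF G'(2) exponent])
    moreover have "{\<xi> \<in> characters G T. \<forall>c\<in>C. \<xi> c = \<eta> c} \<subseteq> {\<xi> \<in> topspace (dual_topology G T). \<phi> \<xi> \<in> U}"
      using local_const[OF _ \<eta>(1)] \<eta>(2) by (auto simp: top X)
    ultimately show "\<exists>W. openin (dual_topology G T) W \<and> \<eta> \<in> W
        \<and> W \<subseteq> {\<xi> \<in> topspace (dual_topology G T). \<phi> \<xi> \<in> U}"
      using \<eta>(1) by blast
  qed
  then have "continuous_map (dual_topology G T) circle_topology \<phi>"
    using \<phi>(1) by (auto simp: continuous_map_def hom_def circle_group_def top Pi_iff)
  then have "\<phi> \<in> carrier (bidual_group G T)"
    using \<phi> by (simp add: bidual_group_def dual_group_def[of "dual_group G T"] characters_def[of "dual_group G T"])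
  then have "\<phi> \<in> canonical_hom G T ` carrier G"
    using refl by (auto simp: reflexive_group_def iso_def bij_betw_def)
  then obtain g where g: "g \<in> carrier G" "\<phi> = canonical_hom G T g" by blast
  show ?thesis
  proof
    show "\<xi> g = 1" if "\<xi> \<in> D" for \<xi>
      using \<phi>(3)[OF that] that D(1) g(2) by (auto simp: canonical_hom_def)
    show "\<xi>\<^sub>0 g \<noteq> 1" using \<phi>(4) \<xi>\<^sub>0(1) g(2) by (auto simp: canonical_hom_def)
  qed (fact g(1))
qed

section \<open>The topology of pointwise convergence\<close>

lemma closedin_Collect_ball:
  assumes "\<And>i. i \<in> I \<Longrightarrow> closedin X {x \<in> topspace X. P i x}"
  shows "closedin X {x \<in> topspace X. \<forall>i\<in>I. P i x}"
proof (cases "I = {}")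
  case False
  then have "{x \<in> topspace X. \<forall>i\<in>I. P i x} = (\<Inter>i\<in>I. {x \<in> topspace X. P i x})" by auto
  then show ?thesis using False assms by auto
qed simp

abbreviation pointwise_topology :: "('a, 'm) monoid_scheme \<Rightarrow> ('a \<Rightarrow> complex) topology" where
  "pointwise_topology G \<equiv> product_topology (\<lambda>_. circle_topology) (carrier G)"

lemma compact_Hausdorff_pointwise_topology:
  "compact_space (pointwise_topology G)" "Hausdorff_space (pointwise_topology G)"
  by (auto simp: compact_space_product_topology compact_space_subtopology Hausdorff_space_product_topology
    Hausdorff_space_subtopology)

lemma continuous_map_pointwise_evaluation:
  "x \<in> carrier G \<Longrightarrow> continuous_map (pointwise_topology G) euclidean (\<lambda>f. f x)"
  using continuous_map_product_projection[of x "carrier G" "\<lambda>_. circle_topology"]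
  by (simp add: continuous_map_in_subtopology)

lemma closedin_pointwise_agree:
  assumes "C \<subseteq> carrier G"
  shows "closedin (pointwise_topology G) {f \<in> topspace (pointwise_topology G). \<forall>c\<in>C. f c = h c}"
proof (rule closedin_Collect_ball)
  fix c assume "c \<in> C"
  then show "closedin (pointwise_topology G) {f \<in> topspace (pointwise_topology G). f c = h c}"
    using assms by (intro closedin_continuous_maps_eq[of euclidean] continuous_map_pointwise_evaluation) auto
qed

lemma characters_subset_pointwise:
  "topspace T = carrier G \<Longrightarrow> characters G T \<subseteq> topspace (pointwise_topology G)"
  by (auto simp: characters_iff PiE_def)

text \<open>
  Continuity is automatic for homomorphisms trivial on \<open>H\<close>. So this set is cut out of a compact product
  of circles by pointwise equations.
\<close>
lemma compactin_pointwise_annihilator_of_open: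
  assumes G: "abelian_topological_group G T" and H: "openin T H" "\<one>\<^bsub>G\<^esub> \<in> H"
  shows "compactin (pointwise_topology G) {\<xi> \<in> characters G T. \<forall>h\<in>H. \<xi> h = 1}"
proof -
  note G' = abelian_topological_groupD[OF G]
  interpret comm_group G by (rule G')
  let ?P = "pointwise_topology G"
  have HG: "H \<subseteq> carrier G" using openin_subset[OF H(1)] G' by simp
  have "closedin ?P {f \<in> topspace ?P. \<forall>x\<in>carrier G. \<forall>y\<in>carrier G. f (x \<otimes>\<^bsub>G\<^esub> y) = f x * f y}"
    by (intro closedin_Collect_ball closedin_continuous_maps_eq[of euclidean] continuous_map_complex_mult
        continuous_map_pointwise_evaluation) auto
  then have "closedin ?P ({f \<in> topspace ?P. \<forall>x\<in>carrier G. \<forall>y\<in>carrier G. f (x \<otimes>\<^bsub>G\<^esub> y) = f x * f y} \<inter>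
      {f \<in> topspace ?P. \<forall>h\<in>H. f h = 1})"
    by (intro closedin_Int closedin_pointwise_agree[OF HG])
  also have "\<dots> = {\<xi> \<in> characters G T. \<forall>h\<in>H. \<xi> h = 1}" (is "?L = ?R")
  proof
    show "?L \<subseteq> ?R"
      by (auto intro!: character_if_trivial_on_open[OF G H] simp: PiE_iff)
    show "?R \<subseteq> ?L"
    proof
      fix \<xi> assume \<xi>: "\<xi> \<in> ?R"
      then have "\<xi> \<in> topspace ?P" using characters_subset_pointwise[OF G'(3)] by blast
      with \<xi> show "\<xi> \<in> ?L" unfolding characters_iff[OF G'(3)] by blast
    qed
  qed
  finally show ?thesis
    by (rule closedin_compact_space[OF compact_Hausdorff_pointwise_topology(1)])
qed

section \<open>Pointwise compact groups of characters\<close>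

text \<open>
  The decisive step: a countable quotient of a compact group is finite, by Baire's theorem. Infinitely many
  restrictions would give rise to an infinite countable quotient, after \<open>K\<close> is cut down to its
  intersection with a group \<open>D\<close> that is open in the compact-open topology; reflexivity is what keeps
  this intersection pointwise compact.
\<close>
lemma finite_restrictions_of_pointwise_compact:
  assumes G: "abelian_topological_group G T" and refl: "reflexive_group G T" and n: "0 < n"
    and exponent: "\<And>x. x \<in> carrier G \<Longrightarrow> x [^]\<^bsub>G\<^esub> (n::nat) = \<one>\<^bsub>G\<^esub>"
    and K: "compactin (pointwise_topology G) K" "K \<subseteq> characters G T" "(\<lambda>x\<in>carrier G. 1) \<in> K"
      "\<And>\<xi> \<eta>. \<xi> \<in> K \<Longrightarrow> \<eta> \<in> K \<Longrightarrow> (\<lambda>x\<in>carrier G. \<xi> x * \<eta> x) \<in> K"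
    and C: "compactin T C"
  shows "finite ((\<lambda>\<xi>. restrict \<xi> C) ` K)"
proof (rule ccontr)
  note G' = abelian_topological_groupD[OF G]
  let ?P = "pointwise_topology G"
  have CG: "C \<subseteq> carrier G" using compactin_subset_topspace[OF C] G' by simp
  have unit: "norm (\<xi> x) = 1" if "\<xi> \<in> characters G T" "x \<in> carrier G" for \<xi> x
    using that by (simp add: characters_iff[OF G'(3)])
  assume "infinite ((\<lambda>\<xi>. restrict \<xi> C) ` K)"
  then obtain r :: "nat \<Rightarrow> 'a \<Rightarrow> complex" where r: "inj r" "range r \<subseteq> (\<lambda>\<xi>. restrict \<xi> C) ` K"
    using infinite_countable_subset by blast
  then have "\<forall>i. \<exists>\<xi>\<in>K. r i = restrict \<xi> C" by blast
  then obtain k where k: "\<And>i. k i \<in> K" "\<And>i. r i = restrict (k i) C" by metis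
  define p where "p l c = (\<Prod>i\<leftarrow>l. k i c)" for l :: "nat list" and c
  \<comment> \<open>by finite exponent this submonoid is the subgroup generated by the \<open>k i\<close> and the characters trivial on \<open>C\<close>\<close>
  define D where "D = {\<xi> \<in> characters G T. \<exists>l. \<forall>c\<in>C. \<xi> c = p l c}"
  have D_sub: "D \<subseteq> characters G T" by (auto simp: D_def)
  have D_one: "(\<lambda>x\<in>carrier G. 1) \<in> D"
    using characters_trivial[OF G] CG by (auto simp: D_def p_def intro!: exI[of _ "[]"])
  have D_mult: "(\<lambda>x\<in>carrier G. \<xi> x * \<eta> x) \<in> D" if \<xi>: "\<xi> \<in> D" and \<eta>: "\<eta> \<in> D" for \<xi> \<eta>
  proof -
    obtain l m where "\<forall>c\<in>C. \<xi> c = p l c" "\<forall>c\<in>C. \<eta> c = p m c" using \<xi> \<eta> unfolding D_def by blast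
    then have "\<forall>c\<in>C. (\<lambda>x\<in>carrier G. \<xi> x * \<eta> x) c = p (l @ m) c" using CG by (auto simp: p_def)
    then show ?thesis unfolding D_def using that D_sub characters_mult[OF G] by blast
  qed
  have D_sat: "\<xi> \<in> D" if "\<xi> \<in> characters G T" "\<forall>c\<in>C. \<xi> c = 1" for \<xi>
    using that by (auto simp: D_def p_def intro!: exI[of _ "[]"])
  \<comment> \<open>\<open>D\<close> is determined within \<open>K\<close> by its annihilator \<open>A\<close>, a pointwise closed condition\<close>
  define A where "A = {g \<in> carrier G. \<forall>\<xi>\<in>D. \<xi> g = 1}"
  define L where "L = K \<inter> D"
  have L_eq: "L = K \<inter> {\<xi> \<in> topspace ?P. \<forall>g\<in>A. \<xi> g = 1}"
  proof
    show "L \<subseteq> K \<inter> {\<xi> \<in> topspace ?P. \<forall>g\<in>A. \<xi> g = 1}"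
      using compactin_subset_topspace[OF K(1)] by (auto simp: L_def A_def)
    show "K \<inter> {\<xi> \<in> topspace ?P. \<forall>g\<in>A. \<xi> g = 1} \<subseteq> L"
    proof
      fix \<xi> assume \<xi>: "\<xi> \<in> K \<inter> {\<xi> \<in> topspace ?P. \<forall>g\<in>A. \<xi> g = 1}"
      have "\<xi> \<in> D"
      proof (rule ccontr)
        assume "\<xi> \<notin> D"
        moreover have "\<xi> \<in> characters G T" using \<xi> K(2) by blast
        ultimately obtain g where "g \<in> carrier G" "\<And>\<eta>. \<eta> \<in> D \<Longrightarrow> \<eta> g = 1" "\<xi> g \<noteq> 1"
          using reflexive_group_separating_element[OF G refl n exponent C D_sub D_one D_mult D_sat]
          by metis
        then show False using \<xi> by (auto simp: A_def)
      qed
      then show "\<xi> \<in> L" using \<xi> by (simp add: L_def)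
    qed
  qed
  have "compactin ?P L"
    unfolding L_eq by (intro compact_Int_closedin K(1) closedin_pointwise_agree) (auto simp: A_def)
  define Y where "Y = subtopology ?P L"
  have topY: "topspace Y = L"
    using compactin_subset_topspace[OF \<open>compactin ?P L\<close>] by (auto simp: Y_def)
  have Y: "compact_space Y" "Hausdorff_space Y"
    using \<open>compactin ?P L\<close> Hausdorff_space_subtopology[OF compact_Hausdorff_pointwise_topology(2), of G L]
    by (simp_all add: Y_def compactin_subspace)
  have L_sub: "L \<subseteq> characters G T" and L_one: "(\<lambda>x\<in>carrier G. 1) \<in> L"
    using K D_one by (auto simp: L_def)
  have L_mult: "(\<lambda>x\<in>carrier G. \<xi> x * \<eta> x) \<in> L" if "\<xi> \<in> L" "\<eta> \<in> L" for \<xi> \<eta>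
    using that K(4) D_mult by (auto simp: L_def)
  have L_power: "(\<lambda>x\<in>carrier G. \<xi> x ^ m) \<in> L" if "\<xi> \<in> L" for \<xi> m
  proof (induction m)
    case 0
    show ?case unfolding power_0 by (rule L_one)
  next
    case (Suc m)
    have eq: "(\<lambda>x\<in>carrier G. \<xi> x ^ Suc m) = (\<lambda>x\<in>carrier G. \<xi> x * (\<lambda>x\<in>carrier G. \<xi> x ^ m) x)" by auto
    show ?case unfolding eq by (rule L_mult[OF that Suc])
  qed
  have kL: "k i \<in> L" for i
    using k(1)[of i] K(2) by (auto simp: L_def D_def p_def intro!: exI[of _ "[i]"])
  define Z where "Z l = {\<xi> \<in> L. \<forall>c\<in>C. \<xi> c = p l c}" for l
  have "closedin Y (Z l)" for l
  proof -
    have "Z l = {f \<in> topspace ?P. \<forall>c\<in>C. f c = p l c} \<inter> L"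
      using topY by (auto simp: Z_def Y_def)
    then show ?thesis unfolding Y_def closedin_subtopology using closedin_pointwise_agree[OF CG] by blast
  qed
  moreover have "Y interior_of \<Union>(range Z) \<noteq> {}"
  proof -
    have cover: "\<Union>(range Z) = topspace Y" unfolding topY by (auto simp: Z_def L_def D_def)
    show ?thesis unfolding cover interior_of_topspace using topY L_one by (metis empty_iff)
  qed
  moreover have "locally_compact_space Y \<and> regular_space Y"
    using Y by (simp add: compact_imp_locally_compact_space compact_Hausdorff_imp_regular_space)
  ultimately have "\<not> (\<forall>l. Y interior_of Z l = {})"
    using Baire_category_alt[of Y "range Z"] by auto
  then obtain l where l: "Y interior_of Z l \<noteq> {}" by blast
  define V where "V = Y interior_of Z l"
  obtain \<xi>\<^sub>1 where \<xi>\<^sub>1: "\<xi>\<^sub>1 \<in> V" using l by (auto simp: V_def)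
  have VZ: "V \<subseteq> Z l" unfolding V_def by (rule interior_of_subset)
  then have \<xi>\<^sub>1L: "\<xi>\<^sub>1 \<in> L" using \<xi>\<^sub>1 by (auto simp: Z_def)
  \<comment> \<open>the translates of the open set \<open>V\<close>; each of them lies in a single class modulo agreement on \<open>C\<close>\<close>
  define M where "M w = {\<xi> \<in> topspace Y. (\<lambda>x\<in>carrier G. \<xi> x * w x) \<in> V}" for w
  have M_open: "openin Y (M w)" if w: "w \<in> L" for w
  proof -
    have "continuous_map Y ?P (\<lambda>\<xi>. \<lambda>x\<in>carrier G. \<xi> x * w x)"
    proof (rule continuous_map_coordinatewise_then_product)
      fix x assume x: "x \<in> carrier G"
      have "continuous_map Y euclidean (\<lambda>\<xi>. \<xi> x * w x)"
        unfolding Y_def using x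
        by (intro continuous_map_complex_mult continuous_map_from_subtopology continuous_map_pointwise_evaluation) auto
      moreover have "norm (\<xi> x * w x) = 1" if "\<xi> \<in> L" for \<xi>
        using that w L_sub unit x by (auto simp: norm_mult subset_iff)
      ultimately show "continuous_map Y circle_topology (\<lambda>\<xi>. (\<lambda>x\<in>carrier G. \<xi> x * w x) x)"
        using x by (auto simp: continuous_map_in_subtopology topY)
    qed auto
    then have "continuous_map Y Y (\<lambda>\<xi>. \<lambda>x\<in>carrier G. \<xi> x * w x)"
      using L_mult[OF _ w] topY by (subst (2) Y_def) (auto simp: continuous_map_in_subtopology)
    then show ?thesis
      unfolding M_def V_def by (rule openin_continuous_map_preimage) auto
  qed
  have M_inj: "i = j" if "w \<in> L" "k i \<in> M w" "k j \<in> M w" for w i j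
  proof -
    have "k i c = k j c" if c: "c \<in> C" for c
    proof -
      have "k i c * w c = p l c" "k j c * w c = p l c"
        using \<open>k i \<in> M w\<close> \<open>k j \<in> M w\<close> c CG VZ by (auto simp: M_def Z_def subset_iff)
      moreover have "norm (w c) = 1" using \<open>w \<in> L\<close> c CG L_sub by (intro unit) auto
      then have "w c \<noteq> 0" by auto
      ultimately show ?thesis by (metis mult_right_cancel)
    qed
    then have "r i = r j" by (auto simp: k(2))
    then show "i = j" using r(1) by (simp add: inj_def)
  qed
  have "topspace Y \<subseteq> \<Union>(M ` L)"
  proof
    fix \<xi> assume "\<xi> \<in> topspace Y"
    then have \<xi>: "\<xi> \<in> L" by (simp add: topY)
    \<comment> \<open>the translation taking \<open>\<xi>\<close> to \<open>\<xi>\<^sub>1\<close>, with the inverse of \<open>\<xi>\<close> written as a power\<close>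
    define w where "w = (\<lambda>x\<in>carrier G. (\<lambda>x\<in>carrier G. \<xi> x ^ (n - 1)) x * \<xi>\<^sub>1 x)"
    have "w \<in> L" unfolding w_def by (intro L_mult L_power \<xi> \<xi>\<^sub>1L)
    moreover have "(\<lambda>x\<in>carrier G. \<xi> x * w x) = \<xi>\<^sub>1"
    proof
      fix x
      have "\<xi> x * (\<xi> x ^ (n - 1) * \<xi>\<^sub>1 x) = \<xi>\<^sub>1 x" if "x \<in> carrier G"
      proof -
        have "\<xi> x ^ n = 1" using character_root_of_unity[OF G'(2) exponent _ that] \<xi> L_sub by blast
        then show ?thesis using n by (simp flip: mult.assoc power_Suc)
      qed
      moreover have "\<xi>\<^sub>1 x = undefined" if "x \<notin> carrier G"
        using \<xi>\<^sub>1L L_sub that by (auto simp: characters_def extensional_def)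
      ultimately show "(\<lambda>x\<in>carrier G. \<xi> x * w x) x = \<xi>\<^sub>1 x" by (simp add: w_def)
    qed
    then have "\<xi> \<in> M w" using \<xi> \<xi>\<^sub>1 by (simp add: M_def topY)
    ultimately show "\<xi> \<in> \<Union>(M ` L)" by blast
  qed
  moreover have "compactin Y (topspace Y)" using Y(1) by (simp add: compact_space_def)
  moreover have "\<And>U. U \<in> M ` L \<Longrightarrow> openin Y U" using M_open by blast
  ultimately have "\<exists>\<F>. finite \<F> \<and> \<F> \<subseteq> M ` L \<and> topspace Y \<subseteq> \<Union>\<F>"
    by (intro compactinD) 
  then obtain \<F> where \<F>: "finite \<F>" "\<F> \<subseteq> M ` L" "topspace Y \<subseteq> \<Union>\<F>" by blast
  have "\<forall>i. \<exists>U\<in>\<F>. k i \<in> U" using kL \<F>(3) topY by blast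
  then obtain u where u: "\<And>i. u i \<in> \<F>" "\<And>i. k i \<in> u i" by metis
  have "inj u"
  proof (rule injI)
    fix i j assume "u i = u j"
    then show "i = j" using u[of i] u[of j] \<F>(2) M_inj by blast
  qed
  moreover have "finite (range u)" using \<F>(1) u(1) by (meson finite_subset image_subsetI)
  ultimately show False using finite_imageD by blast
qed

text \<open>
  The classes of elements of \<open>K\<close> with equal restriction to \<open>C\<close> are closed for pointwise convergence. When
  there are finitely many of them, they are also open.
\<close>
lemma openin_pointwise_agree:
  assumes "K \<subseteq> topspace (pointwise_topology G)" "C \<subseteq> carrier G"
    and fin: "finite ((\<lambda>\<xi>. restrict \<xi> C) ` K)"
  shows "openin (subtopology (pointwise_topology G) K) {\<xi> \<in> K. \<forall>c\<in>C. \<xi> c = \<eta> c}"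
proof -
  let ?Y = "subtopology (pointwise_topology G) K"
  let ?R = "(\<lambda>\<xi>. restrict \<xi> C) ` K - {restrict \<eta> C}"
  have topY: "topspace ?Y = K" using assms(1) by auto
  have "closedin ?Y {\<xi> \<in> K. \<forall>c\<in>C. \<xi> c = h c}" for h
  proof -
    have "{\<xi> \<in> K. \<forall>c\<in>C. \<xi> c = h c} = {\<xi> \<in> topspace (pointwise_topology G). \<forall>c\<in>C. \<xi> c = h c} \<inter> K"
      using assms(1) by auto
    then show ?thesis unfolding closedin_subtopology using closedin_pointwise_agree[OF assms(2)] by blast
  qed
  then have "closedin ?Y (\<Union>h\<in>?R. {\<xi> \<in> K. \<forall>c\<in>C. \<xi> c = h c})"
    using fin by (intro closedin_Union) auto
  moreover have "(\<Union>h\<in>?R. {\<xi> \<in> K. \<forall>c\<in>C. \<xi> c = h c}) = topspace ?Y - {\<xi> \<in> K. \<forall>c\<in>C. \<xi> c = \<eta> c}" (is "?A = ?B")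
  proof
    show "?A \<subseteq> ?B"
    proof
      fix \<xi> assume "\<xi> \<in> ?A"
      then obtain \<zeta> where *: "\<xi> \<in> K" "\<forall>c\<in>C. \<xi> c = restrict \<zeta> C c" "restrict \<zeta> C \<noteq> restrict \<eta> C" by blast
      from *(3) have "\<not> (\<forall>c\<in>C. \<zeta> c = \<eta> c)" by (meson restrict_ext)
      then show "\<xi> \<in> ?B" using * topY by auto
    qed
    show "?B \<subseteq> ?A"
    proof
      fix \<xi> assume \<xi>: "\<xi> \<in> ?B"
      then obtain c where "c \<in> C" "\<xi> c \<noteq> \<eta> c" using topY by blast
      then have "restrict \<xi> C c \<noteq> restrict \<eta> C c" by simp
      then have "restrict \<xi> C \<noteq> restrict \<eta> C" by metis
      then show "\<xi> \<in> ?A" using \<xi> topY by (intro UN_I[of "restrict \<xi> C"]) auto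
    qed
  qed
  ultimately show ?thesis using topY by (subst openin_closedin) auto
qed

text \<open>
  By finiteness of the restrictions, the identity from \<open>K\<close> with the pointwise topology to \<open>K\<close> with
  the compact-open topology is continuous.
\<close>
lemma compactin_dual_topology_of_pointwise_compact:
  assumes G: "abelian_topological_group G T" and refl: "reflexive_group G T" and n: "0 < n"
    and exponent: "\<And>x. x \<in> carrier G \<Longrightarrow> x [^]\<^bsub>G\<^esub> (n::nat) = \<one>\<^bsub>G\<^esub>"
    and K: "compactin (pointwise_topology G) K" "K \<subseteq> characters G T" "(\<lambda>x\<in>carrier G. 1) \<in> K"
      "\<And>\<xi> \<eta>. \<xi> \<in> K \<Longrightarrow> \<eta> \<in> K \<Longrightarrow> (\<lambda>x\<in>carrier G. \<xi> x * \<eta> x) \<in> K"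
  shows "compactin (dual_topology G T) K"
proof -
  note G' = abelian_topological_groupD[OF G]
  let ?Y = "subtopology (pointwise_topology G) K"
  have topY: "topspace ?Y = K" using compactin_subset_topspace[OF K(1)] by auto
  have top: "topspace (dual_topology G T) = characters G T"
    using topspace_dual_topology[OF G'(3)] by (simp add: dual_group_def)
  have "openin ?Y {\<xi> \<in> topspace ?Y. id \<xi> \<in> W}" if W: "openin (dual_topology G T) W" for W
  proof (subst openin_subopen, intro ballI)
    fix \<eta> assume "\<eta> \<in> {\<xi> \<in> topspace ?Y. id \<xi> \<in> W}"
    then have \<eta>: "\<eta> \<in> K" "\<eta> \<in> W" using topY by auto
    obtain C where C: "compactin T C" "{\<xi> \<in> characters G T. \<forall>c\<in>C. \<xi> c = \<eta> c} \<subseteq> W"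
      using dual_topology_nhd[OF G'(3) W \<eta>(2)] by blast
    have "openin ?Y {\<xi> \<in> K. \<forall>c\<in>C. \<xi> c = \<eta> c}"
      using compactin_subset_topspace[OF K(1)] compactin_subset_topspace[OF C(1)] G'(3)
      by (intro openin_pointwise_agree finite_restrictions_of_pointwise_compact[OF G refl n exponent K C(1)]) auto
    moreover have "{\<xi> \<in> K. \<forall>c\<in>C. \<xi> c = \<eta> c} \<subseteq> {\<xi> \<in> topspace ?Y. id \<xi> \<in> W}"
      using C(2) K(2) topY by auto
    ultimately show "\<exists>V. openin ?Y V \<and> \<eta> \<in> V \<and> V \<subseteq> {\<xi> \<in> topspace ?Y. id \<xi> \<in> W}"
      using \<eta>(1) by blast
  qed
  then have "continuous_map ?Y (dual_topology G T) id"
    using K(2) by (auto simp: continuous_map_def topY top)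
  moreover have "compactin ?Y K" using K(1) by (simp add: compactin_subtopology)
  ultimately have "compactin (dual_topology G T) (id ` K)" by (rule image_compactin[rotated])
  then show ?thesis by simp
qed

section \<open>Reflexive groups of finite exponent are Mackey\<close>

theorem theorem1p2:
  fixes G :: "('a, 'm) monoid_scheme" and T :: "'a topology"
  assumes "abelian_topological_group G T"
    and "reflexive_group G T"
    and "finite_exponent G"
  shows "mackey_group G T"
proof -
  note G = assms(1) and refl = assms(2)
  note G' = abelian_topological_groupD[OF G]
  interpret comm_group G by (rule G')
  obtain n :: nat where n: "0 < n" and exponent: "\<And>x. x \<in> carrier G \<Longrightarrow> x [^]\<^bsub>G\<^esub> n = \<one>\<^bsub>G\<^esub>"
    using assms(3) by (auto simp: finite_exponent_def)
  have "openin T U"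
    if N: "abelian_topological_group G N" and lqc: "locally_quasi_convex G N"
      and compat: "characters G T = characters G N" and U: "openin N U" for N U
  proof (subst openin_subopen, intro ballI)
    note N' = abelian_topological_groupD[OF N]
    fix u assume u: "u \<in> U"
    then have uG: "u \<in> carrier G" using openin_subset[OF U] N' by auto
    \<comment> \<open>translate \<open>U\<close> to the identity, where the linear neighbourhood base is available\<close>
    have "openin N {x \<in> topspace N. u \<otimes>\<^bsub>G\<^esub> x \<in> U}"
      by (rule openin_continuous_map_preimage[OF continuous_map_translation[OF N uG] U])
    moreover have "\<one>\<^bsub>G\<^esub> \<in> {x \<in> topspace N. u \<otimes>\<^bsub>G\<^esub> x \<in> U}" using u uG N' by auto
    ultimately obtain S where S: "S \<subseteq> characters G N" "openin N {g \<in> carrier G. \<forall>\<xi>\<in>S. \<xi> g = 1}"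
      "{g \<in> carrier G. \<forall>\<xi>\<in>S. \<xi> g = 1} \<subseteq> {x \<in> topspace N. u \<otimes>\<^bsub>G\<^esub> x \<in> U}"
      using locally_quasi_convex_imp_linear[OF N lqc n exponent] by blast
    define H where "H = {g \<in> carrier G. \<forall>\<xi>\<in>S. \<xi> g = 1}"
    define K where "K = {\<xi> \<in> characters G N. \<forall>h\<in>H. \<xi> h = 1}"
    have H1: "\<one>\<^bsub>G\<^esub> \<in> H" using S(1) character_one[OF N'(2)] by (auto simp: H_def)
    have HG: "H \<subseteq> carrier G" by (auto simp: H_def)
    have cpt: "compactin (pointwise_topology G) K"
      unfolding K_def using S(2) H1 by (intro compactin_pointwise_annihilator_of_open[OF N]) (simp_all add: H_def)
    have dual_cpt: "compactin (dual_topology G T) K"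
    proof (rule compactin_dual_topology_of_pointwise_compact[OF G refl n exponent cpt])
      show "K \<subseteq> characters G T" using compat by (auto simp: K_def)
      show "(\<lambda>x\<in>carrier G. 1) \<in> K" using characters_trivial[OF N] HG by (auto simp: K_def)
      show "(\<lambda>x\<in>carrier G. \<xi> x * \<eta> x) \<in> K" if "\<xi> \<in> K" "\<eta> \<in> K" for \<xi> \<eta>
        using that characters_mult[OF N] HG by (auto simp: K_def)
    qed auto
    have "openin T {g \<in> carrier G. \<forall>\<xi>\<in>K. \<xi> g = 1}"
      by (rule reflexive_group_openin_annihilator[OF G refl n exponent dual_cpt])
    \<comment> \<open>compatibility makes \<open>K\<close> a set of \<open>T\<close>-characters, and \<open>S \<subseteq> K\<close> gives the inclusion from left to right\<close>
    moreover have "{g \<in> carrier G. \<forall>\<xi>\<in>K. \<xi> g = 1} = H"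
      using S(1) by (auto simp: K_def H_def)
    ultimately have HT: "openin T H" by simp
    have "openin T {x \<in> topspace T. inv\<^bsub>G\<^esub> u \<otimes>\<^bsub>G\<^esub> x \<in> H}"
      using uG by (intro openin_continuous_map_preimage[OF continuous_map_translation[OF G] HT]) auto
    moreover have "u \<in> {x \<in> topspace T. inv\<^bsub>G\<^esub> u \<otimes>\<^bsub>G\<^esub> x \<in> H}" using uG G' H1 by auto
    moreover have "{x \<in> topspace T. inv\<^bsub>G\<^esub> u \<otimes>\<^bsub>G\<^esub> x \<in> H} \<subseteq> U"
    proof
      fix x assume x: "x \<in> {x \<in> topspace T. inv\<^bsub>G\<^esub> u \<otimes>\<^bsub>G\<^esub> x \<in> H}"
      then have "u \<otimes>\<^bsub>G\<^esub> (inv\<^bsub>G\<^esub> u \<otimes>\<^bsub>G\<^esub> x) \<in> U" using S(3) by (auto simp: H_def)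
      then show "x \<in> U" using x uG G' by (simp flip: m_assoc)
    qed
    ultimately show "\<exists>V. openin T V \<and> u \<in> V \<and> V \<subseteq> U" by blast
  qed
  then show ?thesis
    unfolding mackey_group_def compatible_topologies_def
    using G reflexive_group_imp_locally_quasi_convex[OF G refl n exponent] by blast
qed

end
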